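(* Let $(W,S)$ be an infinite, non-affine, irreducible Coxeter system of finite rank greater than or equal to $3$, with positive system $\Phi^+$. Then there exists a reflection order on $\Phi^+$ that is not scattered.
   Context: Root system. Let $(W,S)$ be a Coxeter system of finite rank $n$, $S=\{s_1,\dots,s_n\}$, with Coxeter matrix $m$ (the rank is $|S|$). Let $V$ be a real vector space with a symmetric bilinear form $B$, and let $\Pi=\{\alpha_s\mid s\in S\}\subset V$ be a root basis: the $\alpha_s$ are in bijection with $S$; $B(\alpha_s,\alpha_{s'})=-\cos(\pi/m(s,s'))$ if $m(s,s')<\infty$ (so $B(\alpha_s,\alpha_s)=1$); $B(\alpha_s,\alpha_{s'})\le -1$ if $m(s,s')=\infty$; and $\Pi$ is positively independent ($\sum k_s\alpha_s=0$ with all $k_s\ge 0$ forces all $k_s=0$). (For instance, the standard reflection representation, in which $\Pi$ is a basis of $V$ and $B(\alpha_s,\alpha_{s'})=-\cos(\pi/m(s,s'))$, read as $-1$ if $m(s,s')=\infty$.) $W$ acts on $V$ by $s(v)=v-2B(v,\alpha_s)\alpha_s$ for $s\in S$. The root system is $\Phi=W\Pi$, and $\Phi^+$ is the set of roots that are nonnegative linear combinations of $\Pi$; then $\Phi=\Phi^+\sqcup -\Phi^+$. Reflection order. A total order $\prec$ on $\Phi^+$ is a reflection order if for all $\alpha,\beta\in\Phi^+$ with $\alpha\prec\beta$ and all $\gamma=a\alpha+b\beta\in\Phi^+$ with real $a,b>0$, one has $\alpha\prec\gamma\prec\beta$. Scatteredness. A totally ordered set with at least two elements is dense if for any $a\prec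 b$ there is $c$ with $a\prec c\prec b$. A totally ordered set is scattered if it has no subset (with at least two elements) on which the restricted order is dense. An infinite irreducible Coxeter system of finite rank is affine if its standard bilinear form is positive semidefinite but not positive definite; otherwise it is non-affine. *)

theory Defs
  imports
    "HOL-Library.Extended_Nat"
    "HOL-Algebra.Generated_Groups"
    "HOL-Algebra.Group_Action"
    "HOL-Analysis.Linear_Algebra"
begin

definition coxeter_matrix :: "'w set \<Rightarrow> ('w \<Rightarrow> 'w \<Rightarrow> enat) \<Rightarrow> bool" where
  "coxeter_matrix S m \<longleftrightarrow>
     (\<forall>s\<in>S. m s s = 1) \<and>
     (\<forall>s\<in>S. \<forall>t\<in>S. m s t = m t s) \<and>
     (\<forall>s\<in>S. \<forall>t\<in>S. s \<noteq> t \<longrightarrow> 2 \<le> m s t)"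

definition word_prod :: "('w, 'x) monoid_scheme \<Rightarrow> 'w list \<Rightarrow> 'w" where
  "word_prod W ws = foldr (\<lambda>x y. x \<otimes>\<^bsub>W\<^esub> y) ws \<one>\<^bsub>W\<^esub>"

text \<open>
  Insertion of one defining relator (s t)^k, where k = m s t is finite, into a word over S.
  The relators s s are the case s = t, since then m s s = 1.
\<close>

inductive relator_step :: "'w set \<Rightarrow> ('w \<Rightarrow> 'w \<Rightarrow> enat) \<Rightarrow> 'w list \<Rightarrow> 'w list \<Rightarrow> bool"
  for S :: "'w set" and m :: "'w \<Rightarrow> 'w \<Rightarrow> enat" where
  "\<lbrakk>u \<in> lists S; v \<in> lists S; s \<in> S; t \<in> S; m s t = enat k\<rbrakk>
     \<Longrightarrow> relator_step S m (u @ v) (u @ concat (replicate k [s, t]) @ v)"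

text \<open>
  W is the group presented by the generators S and the relations (s t)^(m s t) = 1 for finite
  m s t: the set S generates W, and two words over S have the same value in W if and only if one
  can be transformed into the other by insertions and deletions of relators. Words in the
  generators without formal inverses suffice, because s s is a relator.
\<close>

definition coxeter_system ::
    "('w, 'x) monoid_scheme \<Rightarrow> 'w set \<Rightarrow> ('w \<Rightarrow> 'w \<Rightarrow> enat) \<Rightarrow> bool" where
  "coxeter_system W S m \<longleftrightarrow>
     group W \<and> S \<subseteq> carrier W \<and> generate W S = carrier W \<and> coxeter_matrix S m \<and>
     (\<forall>u\<in>lists S. \<forall>v\<in>lists S.
        word_prod W u = word_prod W v \<longleftrightarrow> equivclp (relator_step S m) u v)"

definition irreducible_coxeter :: "'w set \<Rightarrow> ('w \<Rightarrow> 'w \<Rightarrow> enat) \<Rightarrow> bool" where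
  "irreducible_coxeter S m \<longleftrightarrow>
     S \<noteq> {} \<and> \<not> (\<exists>J. J \<noteq> {} \<and> J \<subset> S \<and> (\<forall>s\<in>J. \<forall>t\<in>S - J. m s t = 2))"

text \<open>
  The standard bilinear form lives on the space of real functions on S. A vector is represented by
  any function that has the given values on S; its values outside S are irrelevant.
\<close>

definition std_entry :: "enat \<Rightarrow> real" where
  "std_entry k = (if k = \<infinity> then - 1 else - cos (pi / real (the_enat k)))"

definition std_form ::
    "'w set \<Rightarrow> ('w \<Rightarrow> 'w \<Rightarrow> enat) \<Rightarrow> ('w \<Rightarrow> real) \<Rightarrow> ('w \<Rightarrow> real) \<Rightarrow> real" where
  "std_form S m x y = (\<Sum>s\<in>S. \<Sum>t\<in>S. x s * y t * std_entry (m s t))"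

definition std_pos_semidef :: "'w set \<Rightarrow> ('w \<Rightarrow> 'w \<Rightarrow> enat) \<Rightarrow> bool" where
  "std_pos_semidef S m \<longleftrightarrow> (\<forall>x. 0 \<le> std_form S m x x)"

definition std_pos_def :: "'w set \<Rightarrow> ('w \<Rightarrow> 'w \<Rightarrow> enat) \<Rightarrow> bool" where
  "std_pos_def S m \<longleftrightarrow> (\<forall>x. (\<exists>s\<in>S. x s \<noteq> 0) \<longrightarrow> 0 < std_form S m x x)"

definition affine_coxeter :: "'w set \<Rightarrow> ('w \<Rightarrow> 'w \<Rightarrow> enat) \<Rightarrow> bool" where
  "affine_coxeter S m \<longleftrightarrow> std_pos_semidef S m \<and> \<not> std_pos_def S m"

definition root_basis ::
    "'w set \<Rightarrow> ('w \<Rightarrow> 'w \<Rightarrow> enat) \<Rightarrow> ('v::real_vector \<Rightarrow> 'v \<Rightarrow> real) \<Rightarrow> ('w \<Rightarrow> 'v) \<Rightarrow> bool" where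
  "root_basis S m B \<alpha> \<longleftrightarrow>
     inj_on \<alpha> S \<and>
     (\<forall>s\<in>S. \<forall>t\<in>S. m s t \<noteq> \<infinity> \<longrightarrow> B (\<alpha> s) (\<alpha> t) = - cos (pi / real (the_enat (m s t)))) \<and>
     (\<forall>s\<in>S. \<forall>t\<in>S. m s t = \<infinity> \<longrightarrow> B (\<alpha> s) (\<alpha> t) \<le> - 1) \<and>
     (\<forall>k. (\<forall>s\<in>S. 0 \<le> k s) \<and> (\<Sum>s\<in>S. k s *\<^sub>R \<alpha> s) = 0 \<longrightarrow> (\<forall>s\<in>S. k s = 0))"

text \<open>
  The action of W on V in which the generators act as reflections. It always exists, and it is
  determined on the carrier of W by the formula for the generators.
\<close>

definition reflection_action ::
    "('w, 'x) monoid_scheme \<Rightarrow> 'w set \<Rightarrow> ('v::real_vector \<Rightarrow> 'v \<Rightarrow> real) \<Rightarrow> ('w \<Rightarrow> 'v)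
      \<Rightarrow> ('w \<Rightarrow> 'v \<Rightarrow> 'v) \<Rightarrow> bool" where
  "reflection_action W S B \<alpha> \<rho> \<longleftrightarrow>
     group_action W UNIV \<rho> \<and>
     (\<forall>s\<in>S. \<forall>v. \<rho> s v = v - (2 * B v (\<alpha> s)) *\<^sub>R \<alpha> s)"

definition roots ::
    "('w, 'x) monoid_scheme \<Rightarrow> 'w set \<Rightarrow> ('w \<Rightarrow> 'v::real_vector) \<Rightarrow> ('w \<Rightarrow> 'v \<Rightarrow> 'v) \<Rightarrow> 'v set" where
  "roots W S \<alpha> \<rho> = {\<rho> w (\<alpha> s) | w s. w \<in> carrier W \<and> s \<in> S}"

definition pos_roots ::
    "('w, 'x) monoid_scheme \<Rightarrow> 'w set \<Rightarrow> ('w \<Rightarrow> 'v::real_vector) \<Rightarrow> ('w \<Rightarrow> 'v \<Rightarrow> 'v) \<Rightarrow> 'v set" where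
  "pos_roots W S \<alpha> \<rho> =
     {\<gamma> \<in> roots W S \<alpha> \<rho>. \<exists>k. (\<forall>s\<in>S. 0 \<le> k s) \<and> \<gamma> = (\<Sum>s\<in>S. k s *\<^sub>R \<alpha> s)}"

text \<open>Total orders are strict: a pair (x, y) in r means that x precedes and differs from y.\<close>

definition reflection_order :: "'v::real_vector set \<Rightarrow> 'v rel \<Rightarrow> bool" where
  "reflection_order P r \<longleftrightarrow>
     r \<subseteq> P \<times> P \<and> strict_linear_order_on P r \<and>
     (\<forall>\<alpha>\<in>P. \<forall>\<beta>\<in>P. (\<alpha>, \<beta>) \<in> r \<longrightarrow>
        (\<forall>a b. 0 < a \<and> 0 < b \<and> a *\<^sub>R \<alpha> + b *\<^sub>R \<beta> \<in> P \<longrightarrow>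
           (\<alpha>, a *\<^sub>R \<alpha> + b *\<^sub>R \<beta>) \<in> r \<and> (a *\<^sub>R \<alpha> + b *\<^sub>R \<beta>, \<beta>) \<in> r))"

definition dense_order :: "'a set \<Rightarrow> 'a rel \<Rightarrow> bool" where
  "dense_order D r \<longleftrightarrow>
     (\<exists>x\<in>D. \<exists>y\<in>D. x \<noteq> y) \<and>
     (\<forall>a\<in>D. \<forall>b\<in>D. (a, b) \<in> r \<longrightarrow> (\<exists>c\<in>D. (a, c) \<in> r \<and> (c, b) \<in> r))"

definition scattered :: "'a set \<Rightarrow> 'a rel \<Rightarrow> bool" where
  "scattered A r \<longleftrightarrow> \<not> (\<exists>D\<subseteq>A. dense_order D r)"

end

theory Submission
  imports Defs "HOL-Analysis.Elementary_Metric_Spaces"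
begin

text \<open>
  Let f be a linear functional that is positive on the simple roots and g any other linear
  functional. The slope g/f of a positive combination of two vectors lies strictly between their
  slopes, so ordering the positive roots by slope gives a reflection order as soon as distinct
  positive roots have distinct slopes. It remains to find f and g for which the set of slopes of
  roots contains a copy of a dense order. A set X of reals does so if its closure contains a
  nonempty set Q without isolated points (\<open>dense_suborder_of_reals\<close>).

  The set Q consists of slopes of limit directions of roots. The form B is indefinite, and this
  yields two roots \<open>\<beta>\<close> and \<open>\<gamma>\<close> with \<open>B \<beta> \<gamma> < -1\<close> (\<open>ex_hyperbolic_pair\<close>). The product h of their
  reflections acts on their plane with two isotropic eigenvectors: it stretches p by a factor
  greater than 1 and shrinks q by the same factor, and it fixes the orthogonal complement of the
  plane. So for every v that is not orthogonal to q, the direction of \<open>h\<^sup>n v\<close> tends to that of p.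
  This is used twice. For a root v in the plane it says that, for each w in W, the slope of \<open>w p\<close>
  is a limit of slopes of the roots \<open>w h\<^sup>n v\<close>. For \<open>v = u p\<close>, where u in W moves the line of p and
  \<open>u p\<close> is not orthogonal to q, it says that the slope of \<open>w p\<close> is a limit of slopes of
  \<open>w h\<^sup>n u p\<close>. If g separates the countably many directions involved, which a generic g does
  (\<open>generic_functional\<close>), then the slopes of the vectors \<open>w p\<close> form a set Q with no isolated point.
  The element u exists because a connected diagram with at least three nodes does not fit into a
  hyperbolic plane (\<open>ex_moving_element\<close>).

  Two facts feed this argument. First, the standard form is not positive semidefinite: the system
  is not affine, and a positive definite form forces W to be finite (\<open>finite_of_pos_def\<close>). Hence, by
  irreducibility and a theorem of the alternative, some positive combination v of the simple roots
  satisfies \<open>B v \<alpha>\<^sub>s < 0\<close> for all s (\<open>ex_negative_vector\<close>). The functional \<open>f = - B v\<close> is the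
  denominator of the slopes, and it is also what produces the pair \<open>\<beta>\<close>, \<open>\<gamma>\<close>. Second, each root is a
  nonnegative or a nonpositive combination of simple roots, because w maps \<open>\<alpha>\<^sub>s\<close> to a nonnegative
  combination whenever right multiplication by s does not shorten w (\<open>nneg_of_ascent\<close>).
\<close>

section \<open>Strict linear inequalities and generic functionals\<close>

text \<open>
  Gordan's theorem of the alternative: if the rows of M are positively independent, then some x has
  a positive product with each row. The induction adds a row a. Subtracting multiples of a from
  the other rows makes one column vanish. If the reduced rows are still positively independent,
  a solution for them can be chosen orthogonal to a, and a small push in a direction that is
  positive on a completes it. Otherwise a itself is a positive multiple of a nonnegative
  combination of the other rows, so any solution for those rows is a solution for a.
\<close>

lemma gordan:
  fixes M :: "'i \<Rightarrow> 't \<Rightarrow> real"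
  assumes "finite I" and T: "finite T"
    and "\<And>k. (\<forall>i\<in>I. 0 \<le> k i) \<Longrightarrow> (\<forall>t\<in>T. (\<Sum>i\<in>I. k i * M i t) = 0) \<Longrightarrow> \<forall>i\<in>I. k i = 0"
  shows "\<exists>x. \<forall>i\<in>I. 0 < (\<Sum>t\<in>T. x t * M i t)"
  using assms(1,3)
proof (induction I arbitrary: M rule: finite_induct)
  case empty
  then show ?case by simp
next
  case (insert a I)
  have "\<exists>t\<in>T. M a t \<noteq> 0"
  proof (rule ccontr)
    assume "\<not> ?thesis"
    then have "\<forall>t\<in>T. (\<Sum>i\<in>insert a I. (if i = a then 1 else 0) * M i t) = 0"
      using insert.hyps by (auto intro!: sum.neutral)
    then have "\<forall>i\<in>insert a I. (if i = a then 1 else 0) = (0::real)"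
      by (intro insert.prems) auto
    then show False by simp
  qed
  then obtain t0 where t0: "t0 \<in> T" "M a t0 \<noteq> 0" by blast
  define h where "h i = M i t0 / M a t0" for i
  define M' where "M' i t = M i t - h i * M a t" for i t
  show ?case
  proof (cases "\<forall>k. (\<forall>i\<in>I. 0 \<le> k i) \<longrightarrow> (\<forall>t\<in>T. (\<Sum>i\<in>I. k i * M' i t) = 0) \<longrightarrow> (\<forall>i\<in>I. k i = 0)")
    case True
    then obtain x' where x': "\<forall>i\<in>I. 0 < (\<Sum>t\<in>T. x' t * M' i t)"
      using insert.IH[of M'] by blast
    \<comment> \<open>the correction at t0 by \<open>(e - c) / M a t0\<close> gives row a the value e and row i its reduced value plus \<open>e * h i\<close>\<close>
    define c where "c = (\<Sum>u\<in>T. x' u * M a u)"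
    have "eventually (\<lambda>e::real. \<forall>i\<in>I. 0 < (\<Sum>t\<in>T. x' t * M' i t) + e * h i) (at_right 0)"
    proof (intro eventually_ball_finite ballI)
      fix i assume "i \<in> I"
      then have pos: "0 < (\<Sum>t\<in>T. x' t * M' i t) + 0 * h i" using x' by simp
      have "((\<lambda>e. (\<Sum>t\<in>T. x' t * M' i t) + e * h i) \<longlongrightarrow> (\<Sum>t\<in>T. x' t * M' i t) + 0 * h i) (at_right 0)"
        by (intro tendsto_intros)
      from order_tendstoD(1)[OF this pos]
      show "eventually (\<lambda>e::real. 0 < (\<Sum>t\<in>T. x' t * M' i t) + e * h i) (at_right 0)" .
    qed (use insert.hyps in auto)
    then have "eventually (\<lambda>e::real. 0 < e \<and> (\<forall>i\<in>I. 0 < (\<Sum>t\<in>T. x' t * M' i t) + e * h i)) (at_right 0)"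
      by (intro eventually_conj eventually_at_right_less)
    then obtain e :: real where e: "0 < e" "\<forall>i\<in>I. 0 < (\<Sum>t\<in>T. x' t * M' i t) + e * h i"
      using eventually_happens'[of "at_right (0::real)"] by (auto simp: trivial_limit_at_right_real)
    define x where "x t = x' t + (if t = t0 then (e - c) / M a t0 else 0)" for t
    have x: "(\<Sum>t\<in>T. x t * M i t) = (\<Sum>t\<in>T. x' t * M' i t) + e * h i" for i
    proof -
      have "(\<Sum>t\<in>T. x t * M i t) = (\<Sum>t\<in>T. x' t * M i t) + (\<Sum>t\<in>T. if t = t0 then (e - c) / M a t0 * M i t else 0)"
        unfolding sum.distrib[symmetric] by (rule sum.cong) (auto simp: x_def algebra_simps)
      also have "\<dots> = (\<Sum>t\<in>T. x' t * M i t) + (e - c) * h i"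
        using t0 T by (simp add: h_def)
      also have "(\<Sum>t\<in>T. x' t * M i t) = (\<Sum>t\<in>T. x' t * M' i t) + c * h i"
        unfolding c_def sum_distrib_right sum.distrib[symmetric]
        by (rule sum.cong) (auto simp: M'_def algebra_simps)
      finally show ?thesis by (simp add: algebra_simps)
    qed
    have "h a = 1" "\<forall>t. M' a t = 0" using t0 by (auto simp: h_def M'_def)
    then show ?thesis using e by (intro exI[of _ x]) (auto simp: x)
  next
    case False
    then obtain k j where k: "\<forall>i\<in>I. 0 \<le> k i" "\<forall>t\<in>T. (\<Sum>i\<in>I. k i * M' i t) = 0" "j \<in> I" "k j \<noteq> 0"
      by blast
    define c where "c = (\<Sum>i\<in>I. k i * h i)"
    have kM: "(\<Sum>i\<in>I. k i * M i t) = c * M a t" if "t \<in> T" for t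
    proof -
      have "(\<Sum>i\<in>I. k i * M i t) = (\<Sum>i\<in>I. k i * M' i t) + c * M a t"
        unfolding c_def sum_distrib_right sum.distrib[symmetric]
        by (rule sum.cong) (auto simp: M'_def algebra_simps)
      with k that show ?thesis by simp
    qed
    have ext: "(\<Sum>i\<in>insert a I. (k'(a := d)) i * M i t) = d * M a t + (\<Sum>i\<in>I. k' i * M i t)" for k' d t
    proof -
      have "(\<Sum>i\<in>I. (k'(a := d)) i * M i t) = (\<Sum>i\<in>I. k' i * M i t)"
        using insert.hyps by (intro sum.cong) auto
      then show ?thesis using insert.hyps by simp
    qed
    have "0 < c"
    proof (rule ccontr)
      assume "\<not> 0 < c"
      then have "\<forall>i\<in>insert a I. (k(a := - c)) i = 0"
        using k kM by (intro insert.prems) (auto simp only: ext, auto)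
      then have "(k(a := - c)) j = 0" using k(3) by blast
      then show False using k(3,4) insert.hyps by (auto split: if_splits)
    qed
    have "\<exists>x. \<forall>i\<in>I. 0 < (\<Sum>t\<in>T. x t * M i t)"
    proof (rule insert.IH)
      fix k' :: "'i \<Rightarrow> real"
      assume "\<forall>i\<in>I. 0 \<le> k' i" "\<forall>t\<in>T. (\<Sum>i\<in>I. k' i * M i t) = 0"
      then have "\<forall>i\<in>insert a I. (k'(a := 0)) i = 0"
        by (intro insert.prems) (auto simp only: ext, auto)
      then show "\<forall>i\<in>I. k' i = 0" using insert.hyps(2) by (metis fun_upd_apply insertCI)
    qed
    then obtain x where x: "\<forall>i\<in>I. 0 < (\<Sum>t\<in>T. x t * M i t)" by blast
    have "c * (\<Sum>t\<in>T. x t * M a t) = (\<Sum>t\<in>T. x t * (c * M a t))"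
      by (simp add: sum_distrib_left mult_ac)
    also have "\<dots> = (\<Sum>t\<in>T. x t * (\<Sum>i\<in>I. k i * M i t))"
      by (rule sum.cong) (simp_all add: kM)
    also have "\<dots> = (\<Sum>i\<in>I. k i * (\<Sum>t\<in>T. x t * M i t))"
      unfolding sum_distrib_left by (subst sum.swap) (simp add: mult_ac)
    also have "\<dots> > 0"
    proof (rule sum_pos2[OF insert.hyps(1) k(3)])
      show "0 < k j * (\<Sum>t\<in>T. x t * M j t)"
        using k x by (metis less_eq_real_def mult_pos_pos)
    qed (use k x in \<open>auto intro!: mult_nonneg_nonneg simp: less_imp_le\<close>)
    finally have "0 < (\<Sum>t\<in>T. x t * M a t)" using \<open>0 < c\<close> by (simp add: zero_less_mult_iff)
    then show ?thesis using x by blast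
  qed
qed

text \<open>
  A finite-dimensional real space is not covered by countably many hyperplanes. Choosing the
  coordinates of x one after the other, each vector of N excludes at most one value of the
  coordinate in question.
\<close>

lemma generic_coefficients:
  fixes N :: "('t \<Rightarrow> real) set"
  assumes "finite T" "countable N" "\<And>v. v \<in> N \<Longrightarrow> \<exists>t\<in>T. v t \<noteq> 0"
  shows "\<exists>x. \<forall>v\<in>N. (\<Sum>t\<in>T. x t * v t) \<noteq> 0"
  using assms
proof (induction T arbitrary: N rule: finite_induct)
  case empty
  then show ?case by auto
next
  case (insert a T)
  have "\<exists>x. \<forall>v\<in>{v\<in>N. \<exists>t\<in>T. v t \<noteq> 0}. (\<Sum>t\<in>T. x t * v t) \<noteq> 0"
    by (rule insert.IH) (use insert.prems in auto)
  then obtain x where x: "\<And>v. v \<in> N \<Longrightarrow> \<exists>t\<in>T. v t \<noteq> 0 \<Longrightarrow> (\<Sum>t\<in>T. x t * v t) \<noteq> 0" by blast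
  have "countable ((\<lambda>v. - (\<Sum>t\<in>T. x t * v t) / v a) ` N)" using insert.prems by blast
  then obtain c where c: "c \<notin> (\<lambda>v. - (\<Sum>t\<in>T. x t * v t) / v a) ` N"
    using uncountable_UNIV_real by (metis UNIV_eq_I)
  have "(\<Sum>t\<in>insert a T. (x(a := c)) t * v t) \<noteq> 0" if "v \<in> N" for v
  proof -
    have "(\<Sum>t\<in>T. (x(a := c)) t * v t) = (\<Sum>t\<in>T. x t * v t)"
      using insert.hyps by (intro sum.cong) auto
    then have eq: "(\<Sum>t\<in>insert a T. (x(a := c)) t * v t) = c * v a + (\<Sum>t\<in>T. x t * v t)"
      using insert.hyps by simp
    show ?thesis
    proof (cases "v a = 0")
      case True
      then have "\<exists>t\<in>T. v t \<noteq> 0" using insert.prems(2)[OF that] by auto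
      then show ?thesis using x that True unfolding eq by simp
    next
      case False
      have "c \<noteq> - (\<Sum>t\<in>T. x t * v t) / v a" using c that by blast
      then show ?thesis using False unfolding eq by (simp add: field_simps eq_neg_iff_add_eq_0)
    qed
  qed
  then show ?case by blast
qed

lemma generic_functional:
  fixes A N :: "'v::real_vector set"
  assumes "finite A" "countable N" "N \<subseteq> span A" "0 \<notin> N"
  shows "\<exists>g::'v \<Rightarrow> real. linear g \<and> (\<forall>v\<in>N. g v \<noteq> 0)"
proof -
  obtain T where T: "T \<subseteq> A" "independent T" "A \<subseteq> span T"
    using maximal_independent_subset by blast
  \<comment> \<open>coordinates with respect to a basis of the whole space are linear everywhere, not only on the span of A\<close>
  define E where "E = extend_basis T"
  have E: "independent E" "span E = UNIV" "T \<subseteq> E"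
    unfolding E_def using independent_extend_basis[OF T(2)] span_extend_basis[OF T(2)]
      extend_basis_superset[OF T(2)] by blast+
  have fT: "finite T" using T assms finite_subset by blast
  have sp: "span A \<subseteq> span T" using T by (simp add: span_minimal)
  have "\<exists>x. \<forall>c\<in>representation E ` N. (\<Sum>t\<in>T. x t * c t) \<noteq> 0"
  proof (rule generic_coefficients[OF fT])
    show "countable (representation E ` N)" using assms by blast
    fix c assume "c \<in> representation E ` N"
    then obtain v where v: "v \<in> N" "c = representation E v" by blast
    then have "v \<in> span T" "v \<noteq> 0" using assms sp by auto
    then have "c = representation T v" using representation_extend[OF E(1) _ E(3)] v by simp
    moreover have "(\<Sum>b | representation T v b \<noteq> 0. representation T v b *\<^sub>R b) = v"
      using sum_nonzero_representation_eq[OF T(2) \<open>v \<in> span T\<close>] .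
    ultimately have "\<exists>t. c t \<noteq> 0" using \<open>v \<noteq> 0\<close> by (metis (mono_tags, lifting) Collect_empty_eq sum.empty)
    then show "\<exists>t\<in>T. c t \<noteq> 0" using \<open>c = representation T v\<close> representation_ne_zero by metis
  qed
  then obtain x where x: "\<And>v. v \<in> N \<Longrightarrow> (\<Sum>t\<in>T. x t * representation E v t) \<noteq> 0" by auto
  have "linear (\<lambda>v. \<Sum>t\<in>T. x t * representation E v t)"
    by (rule linearI)
      (simp_all add: representation_add[OF E(1)] representation_scale[OF E(1)] E(2)
        algebra_simps sum.distrib sum_distrib_left)
  then show ?thesis using x by blast
qed

section \<open>Dense suborders of the real line\<close>

text \<open>
  Points of X are identified when only finitely many points of Q lie between them. Points of X that
  are not identified have infinitely many points of Q between them. These points are limits of Q and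
  of X, so there is a point of X in between that is identified with neither. Hence any
  set of representatives is densely ordered.
\<close>

lemma dense_suborder_of_reals:
  fixes X Q :: "real set"
  assumes ne: "Q \<noteq> {}" and lim: "\<And>q. q \<in> Q \<Longrightarrow> q islimpt Q" and cl: "Q \<subseteq> closure X"
  shows "\<exists>D\<subseteq>X. (\<exists>x\<in>D. \<exists>y\<in>D. x \<noteq> y) \<and> (\<forall>a\<in>D. \<forall>b\<in>D. a < b \<longrightarrow> (\<exists>c\<in>D. a < c \<and> c < b))"
proof -
  have inf: "infinite (Q \<inter> {a..b})" if "q \<in> Q" "a < q" "q < b" for a b q
  proof -
    have "infinite (Q \<inter> {a<..<b})"
      using lim[OF that(1)] that unfolding islimpt_eq_acc_point by (metis greaterThanLessThan_iff open_greaterThanLessThan Int_commute)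
    moreover have "Q \<inter> {a<..<b} \<subseteq> Q \<inter> {a..b}" by auto
    ultimately show ?thesis using finite_subset by blast
  qed
  have split: "\<exists>x\<in>X. a < x \<and> x < b \<and> infinite (Q \<inter> {a..x}) \<and> infinite (Q \<inter> {x..b})"
    if "infinite (Q \<inter> {a..b})" for a b
  proof -
    have "infinite (Q \<inter> {a..b} - {a, b})" using that by simp
    moreover have "Q \<inter> {a..b} - {a, b} = Q \<inter> {a<..<b}" by auto
    ultimately have inf': "infinite (Q \<inter> {a<..<b})" by simp
    have "\<exists>p\<in>A. \<exists>q\<in>A. \<exists>r\<in>A. p < q \<and> q < r" if A: "infinite A" for A :: "real set"
    proof -
      obtain p where p: "p \<in> A" using infinite_imp_nonempty[OF A] by blast
      obtain q where q: "q \<in> A" "q \<noteq> p"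
        using infinite_imp_nonempty[OF infinite_remove[OF A, of p]] by blast
      have "infinite (A - {p, q})" using A by simp
      then obtain r where r: "r \<in> A" "r \<noteq> p" "r \<noteq> q"
        by (metis Diff_iff ex_in_conv finite.emptyI insertCI)
      show ?thesis using p q r by (metis linorder_neqE)
    qed
    from this[OF inf'] obtain p q r where pqr: "p \<in> Q" "q \<in> Q" "r \<in> Q" "a < p" "p < q" "q < r" "r < b"
      by auto
    have "q \<in> closure X" using pqr cl by blast
    then have "X \<inter> {p<..<r} \<noteq> {}"
      using pqr by (metis closure_iff_nhds_not_empty greaterThanLessThan_iff open_greaterThanLessThan order_refl)
    then obtain x where "x \<in> X" "p < x" "x < r" by auto
    then show ?thesis using pqr inf by (intro bexI[of _ x]) auto
  qed
  \<comment> \<open>the interval is written with min and max so that the relation is symmetric\<close>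
  define R where "R x y \<longleftrightarrow> finite (Q \<inter> {min x y..max x y})" for x y
  have R_refl: "R x x" for x by (auto simp: R_def)
  have R_sym: "R x y \<longleftrightarrow> R y x" for x y by (simp add: R_def min.commute max.commute)
  have R_trans: "R x z" if "R x y" "R y z" for x y z
  proof -
    have "Q \<inter> {min x z..max x z} \<subseteq> (Q \<inter> {min x y..max x y}) \<union> (Q \<inter> {min y z..max y z})"
      by (auto simp: min_def max_def split: if_splits)
    then show ?thesis using that unfolding R_def by (meson finite_UnI finite_subset)
  qed
  define rep where "rep x = (SOME y. y \<in> X \<and> R x y)" for x
  have rep: "rep x \<in> X" "R x (rep x)" if "x \<in> X" for x
    using someI[of "\<lambda>y. y \<in> X \<and> R x y" x] that R_refl by (auto simp: rep_def)
  have rep_eq: "rep x = rep y" if "R x y" for x y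
  proof -
    have "R x = R y" using that R_trans R_sym by blast
    then show ?thesis by (simp add: rep_def)
  qed
  let ?D = "rep ` X"
  have nR: "infinite (Q \<inter> {a..b})" if ab: "a \<in> ?D" "b \<in> ?D" "a < b" for a b
  proof
    assume "finite (Q \<inter> {a..b})"
    then have "R a b" using ab by (simp add: R_def)
    moreover obtain x y where xy: "x \<in> X" "y \<in> X" "a = rep x" "b = rep y" using ab by blast
    ultimately have "R x y" using rep R_trans R_sym by metis
    then show False using rep_eq xy ab by auto
  qed
  have dense: "\<exists>c\<in>?D. a < c \<and> c < b" if ab: "a \<in> ?D" "b \<in> ?D" "a < b" for a b
  proof -
    obtain x where x: "x \<in> X" "a < x" "x < b" "infinite (Q \<inter> {a..x})" "infinite (Q \<inter> {x..b})"
      using split[OF nR[OF ab]] by blast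
    have Rx: "R x (rep x)" using rep x by blast
    have "a < rep x"
    proof (rule ccontr)
      assume "\<not> a < rep x"
      then have "Q \<inter> {a..x} \<subseteq> Q \<inter> {min x (rep x)..max x (rep x)}" by (auto simp: min_def max_def)
      then show False using Rx x finite_subset unfolding R_def by blast
    qed
    moreover have "rep x < b"
    proof (rule ccontr)
      assume "\<not> rep x < b"
      then have "Q \<inter> {x..b} \<subseteq> Q \<inter> {min x (rep x)..max x (rep x)}" by (auto simp: min_def max_def)
      then show False using Rx x finite_subset unfolding R_def by blast
    qed
    ultimately show ?thesis using x by blast
  qed
  obtain q where q: "q \<in> Q" using ne by blast
  have "infinite (Q \<inter> {q - 1..q + 1})" using inf[OF q] by simp
  from split[OF this] obtain x where x: "x \<in> X" "infinite (Q \<inter> {x..q + 1})" by blast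
  from split[OF x(2)] obtain y where y: "y \<in> X" "x < y" "infinite (Q \<inter> {x..y})" by blast
  have "rep x \<noteq> rep y"
  proof
    assume "rep x = rep y"
    then have "R x y" using rep x y R_trans R_sym by metis
    then show False using y by (simp add: R_def)
  qed
  moreover have "?D \<subseteq> X" using rep by blast
  ultimately show ?thesis using dense x y by (intro exI[of _ ?D]) blast
qed

section \<open>Ordering a cone by slope\<close>

text \<open>
  The slope of \<open>a x + b y\<close> is the mediant \<open>(a g x + b g y) / (a f x + b f y)\<close>, which lies strictly
  between the slopes of x and y.
\<close>

lemma reflection_order_of_slope:
  fixes f g :: "'v::real_vector \<Rightarrow> real"
  assumes f: "linear f" and g: "linear g" and pos: "\<And>x. x \<in> P \<Longrightarrow> 0 < f x"
    and inj: "inj_on (\<lambda>x. g x / f x) P"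
  shows "reflection_order P {(x, y) \<in> P \<times> P. g x / f x < g y / f y}"
proof -
  let ?r = "{(x, y) \<in> P \<times> P. g x / f x < g y / f y}"
  have "strict_linear_order_on P ?r"
    unfolding strict_linear_order_on_def
  proof (intro conjI)
    show "trans ?r" by (auto intro!: transI)
    show "irrefl ?r" by (auto simp: irrefl_def)
    show "total_on P ?r"
      unfolding total_on_def
    proof (intro ballI impI)
      fix x y assume xy: "x \<in> P" "y \<in> P" "x \<noteq> y"
      then have "g x / f x \<noteq> g y / f y" using inj by (auto dest: inj_onD)
      then show "(x, y) \<in> ?r \<or> (y, x) \<in> ?r" using xy by auto
    qed
  qed
  moreover have "(x, a *\<^sub>R x + b *\<^sub>R y) \<in> ?r \<and> (a *\<^sub>R x + b *\<^sub>R y, y) \<in> ?r"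
    if xy: "(x, y) \<in> ?r" and ab: "0 < a" "0 < b" and P: "a *\<^sub>R x + b *\<^sub>R y \<in> P" for x y a b
  proof -
    have x: "x \<in> P" "y \<in> P" and fxy: "0 < f x" "0 < f y" using xy pos by auto
    have lt: "g x * f y < g y * f x" using xy fxy by (simp add: field_simps)
    have fz: "f (a *\<^sub>R x + b *\<^sub>R y) = a * f x + b * f y" and gz: "g (a *\<^sub>R x + b *\<^sub>R y) = a * g x + b * g y"
      using f g by (simp_all add: linear_add linear_scale)
    have den: "0 < a * f x + b * f y" using fxy ab by (simp add: add_pos_pos)
    have "b * (g x * f y) < b * (g y * f x)" "a * (g x * f y) < a * (g y * f x)" using lt ab by auto
    then show ?thesis using x P fxy den unfolding fz gz mem_Collect_eq case_prod_conv
      by (simp add: fz gz divide_less_eq less_divide_eq) (simp add: algebra_simps)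
  qed
  ultimately show ?thesis unfolding reflection_order_def by blast
qed

lemma not_scattered_of_slope:
  fixes k :: "'v \<Rightarrow> real"
  assumes "D \<subseteq> k ` P" "\<exists>x\<in>D. \<exists>y\<in>D. x \<noteq> y" "\<forall>a\<in>D. \<forall>b\<in>D. a < b \<longrightarrow> (\<exists>c\<in>D. a < c \<and> c < b)"
  shows "\<not> scattered P {(x, y) \<in> P \<times> P. k x < k y}"
proof -
  let ?i = "inv_into P k"
  have i: "?i d \<in> P" "k (?i d) = d" if "d \<in> D" for d
    using that assms(1) by (auto intro: inv_into_into f_inv_into_f)
  have "dense_order (?i ` D) {(x, y) \<in> P \<times> P. k x < k y}"
    unfolding dense_order_def
  proof (intro conjI ballI impI)
    obtain x y where "x \<in> D" "y \<in> D" "x \<noteq> y" using assms(2) by blast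
    then show "\<exists>x\<in>?i ` D. \<exists>y\<in>?i ` D. x \<noteq> y" using i by (metis imageI)
  next
    fix a b assume "a \<in> ?i ` D" "b \<in> ?i ` D" and ab: "(a, b) \<in> {(x, y) \<in> P \<times> P. k x < k y}"
    then have "k a \<in> D" "k b \<in> D" "k a < k b" using i by auto
    then obtain c where "c \<in> D" "k a < c" "c < k b" using assms(3) by blast
    then show "\<exists>c\<in>?i ` D. (a, c) \<in> {(x, y) \<in> P \<times> P. k x < k y} \<and> (c, b) \<in> {(x, y) \<in> P \<times> P. k x < k y}"
      using i ab by (intro bexI[of _ "?i c"]) auto
  qed
  then show ?thesis unfolding scattered_def using i by blast
qed

section \<open>Alternating words and Chebyshev numbers\<close>

text \<open>
  The letters s and t in turn, k letters in all, the last one being t. Counting from the end makes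
  the recursion match the order in which the letters of a word act on a vector.
\<close>

fun alternating_word :: "nat \<Rightarrow> 'a \<Rightarrow> 'a \<Rightarrow> 'a list" where
  "alternating_word 0 s t = []"
| "alternating_word (Suc k) s t = alternating_word k t s @ [t]"

lemma length_alternating_word [simp]: "length (alternating_word k s t) = k"
  by (induction k s t rule: alternating_word.induct) auto

lemma set_alternating_word: "set (alternating_word k s t) \<subseteq> {s, t}"
  by (induction k s t rule: alternating_word.induct) auto

lemma alternating_word_add:
  "\<exists>u. alternating_word (i + j) s t = u @ alternating_word j s t \<and> length u = i \<and> set u \<subseteq> {s, t}"
proof (induction j arbitrary: s t)
  case 0
  then show ?case using set_alternating_word[of i s t] by auto
next
  case (Suc j)
  from Suc[of t s] show ?case by auto
qed

lemma alternating_word_relator: "alternating_word (2 * k) s t = concat (replicate k [s, t])"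
proof (induction k)
  case (Suc k)
  have "alternating_word (2 * Suc k) s t = concat (replicate k [s, t]) @ [s, t]" using Suc by simp
  also have "\<dots> = concat (replicate k [s, t] @ [[s, t]])" by simp
  also have "\<dots> = concat (replicate (Suc k) [s, t])" by (simp only: replicate_append_same replicate_Suc)
  finally show ?case .
qed auto

lemma alternating_word_unique:
  assumes "distinct_adj y" "set y \<subseteq> {s, t}" "y = [] \<or> last y = t"
  shows "y = alternating_word (length y) s t"
  using assms
proof (induction y arbitrary: s t rule: rev_induct)
  case (snoc p y)
  then have p: "p = t" by simp
  have "y = alternating_word (length y) t s"
  proof (rule snoc.IH)
    show "distinct_adj y" using snoc.prems by (simp add: distinct_adj_append_iff)
    show "set y \<subseteq> {t, s}" using snoc.prems by auto
    show "y = [] \<or> last y = s"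
    proof (cases "y = []")
      case False
      then have "last y \<noteq> t" "last y \<in> set y"
        using snoc.prems p by (auto simp: distinct_adj_append_iff)
      then show ?thesis using snoc.prems by auto
    qed simp
  qed
  then show ?case using p by simp
qed simp

lemma not_distinct_adj: "\<not> distinct_adj y \<Longrightarrow> \<exists>y1 p y2. y = y1 @ p # p # y2"
proof (induction y)
  case (Cons a y)
  show ?case
  proof (cases "distinct_adj y")
    case True
    with Cons.prems obtain y' where "y = a # y'" by (cases y) auto
    then show ?thesis by (intro exI[of _ "[]"]) auto
  next
    case False
    then obtain y1 p y2 where "y = y1 @ p # p # y2" using Cons.IH by blast
    then show ?thesis by (intro exI[of _ "a # y1"]) auto
  qed
qed simp

text \<open>
  The Chebyshev polynomials of the second kind, shifted by one. They are the coordinates of the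
  images of a simple root under a dihedral group, with \<open>a = - B \<alpha>\<^sub>s \<alpha>\<^sub>t\<close>.
\<close>

fun cheb :: "real \<Rightarrow> nat \<Rightarrow> real" where
  "cheb a 0 = 0"
| "cheb a (Suc 0) = 1"
| "cheb a (Suc (Suc n)) = 2 * a * cheb a (Suc n) - cheb a n"

text \<open>
  For finite m the coefficient a is the cosine of \<open>\<pi> / m\<close>. Then the n-th number of the recurrence is
  \<open>sin (n \<pi> / m) / sin (\<pi> / m)\<close>, which is nonnegative up to \<open>n = m\<close>.
\<close>

lemma cheb_cos: "cheb (cos x) n * sin x = sin (real n * x)"
proof (induction "cos x" n rule: cheb.induct)
  case (3 n)
  have e: "real (Suc (Suc n)) * x = real (Suc n) * x + x" "real n * x = real (Suc n) * x - x"
    by (simp_all add: algebra_simps)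
  have "cheb (cos x) (Suc (Suc n)) * sin x
      = 2 * cos x * (cheb (cos x) (Suc n) * sin x) - cheb (cos x) n * sin x"
    by (simp add: algebra_simps)
  also have "\<dots> = 2 * cos x * sin (real (Suc n) * x) - sin (real n * x)"
    using 3 by simp
  also have "\<dots> = sin (real (Suc (Suc n)) * x)"
    unfolding e sin_add sin_diff by simp
  finally show ?case .
qed auto

text \<open>
  This covers \<open>m = \<infinity>\<close>, where the coefficient a is at least 1.
\<close>

lemma cheb_mono: "1 \<le> a \<Longrightarrow> 0 \<le> cheb a n \<and> cheb a n \<le> cheb a (Suc n)"
proof (induction n)
  case (Suc n)
  then have h: "0 \<le> cheb a (Suc n)" "cheb a n \<le> cheb a (Suc n)" by auto
  have "1 * cheb a (Suc n) \<le> a * cheb a (Suc n)" using h Suc.prems by (intro mult_right_mono)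
  then show ?case using h by simp
qed simp

section \<open>The reflection representation\<close>

locale coxeter_rep =
  fixes W :: "('w, 'x) monoid_scheme" (structure)
    and S :: "'w set"
    and m :: "'w \<Rightarrow> 'w \<Rightarrow> enat"
    and B :: "'v::real_vector \<Rightarrow> 'v \<Rightarrow> real"
    and \<alpha> :: "'w \<Rightarrow> 'v"
    and \<rho> :: "'w \<Rightarrow> 'v \<Rightarrow> 'v"
  assumes cox: "coxeter_system W S m"
    and finS: "finite S"
    and bil: "bilinear B"
    and sym: "\<And>u v. B u v = B v u"
    and basis: "root_basis S m B \<alpha>"
    and act: "reflection_action W S B \<alpha> \<rho>"
begin

sublocale group W using cox by (simp add: coxeter_system_def)

lemma S_carrier: "S \<subseteq> carrier W" using cox by (simp add: coxeter_system_def)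

lemma gen_in: "s \<in> S \<Longrightarrow> s \<in> carrier W" using S_carrier by blast

lemma word_prod_Nil [simp]: "word_prod W [] = \<one>"
  by (simp add: word_prod_def)

lemma word_prod_Cons [simp]: "word_prod W (s # ws) = s \<otimes> word_prod W ws"
  by (simp add: word_prod_def)

lemma word_prod_closed: "ws \<in> lists S \<Longrightarrow> word_prod W ws \<in> carrier W"
  by (induction ws) (auto simp: gen_in)

lemma word_prod_append:
  "u \<in> lists S \<Longrightarrow> v \<in> lists S \<Longrightarrow> word_prod W (u @ v) = word_prod W u \<otimes> word_prod W v"
  by (induction u) (auto simp: gen_in word_prod_closed m_assoc)

lemma word_prod_relator:
  assumes "s \<in> S" "t \<in> S" "m s t = enat k"
  shows "word_prod W (concat (replicate k [s, t])) = \<one>"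
proof -
  have "relator_step S m ([] @ []) ([] @ concat (replicate k [s, t]) @ [])"
    using assms by (intro relator_step.intros) auto
  then have "equivclp (relator_step S m) [] (concat (replicate k [s, t]))"
    by (intro r_into_equivclp) simp
  moreover have "concat (replicate k [s, t]) \<in> lists S"
    using set_alternating_word[of "2 * k" s t] assms unfolding alternating_word_relator[symmetric] by auto
  ultimately show ?thesis using cox by (metis coxeter_system_def lists.Nil word_prod_Nil)
qed

lemma m_sym: "s \<in> S \<Longrightarrow> t \<in> S \<Longrightarrow> m s t = m t s"
  and m_diag: "s \<in> S \<Longrightarrow> m s s = 1"
  and m_ge2: "s \<in> S \<Longrightarrow> t \<in> S \<Longrightarrow> s \<noteq> t \<Longrightarrow> 2 \<le> m s t"
  using cox by (auto simp: coxeter_system_def coxeter_matrix_def)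

lemma gen_sq: "s \<in> S \<Longrightarrow> s \<otimes> s = \<one>"
  using word_prod_relator[of s s 1] by (simp add: m_diag one_enat_def gen_in)

lemma inv_gen: "s \<in> S \<Longrightarrow> inv s = s"
  using gen_sq gen_in by (simp add: inv_equality)

lemma word_of: "w \<in> carrier W \<Longrightarrow> \<exists>ws\<in>lists S. word_prod W ws = w"
proof -
  assume "w \<in> carrier W"
  then have "w \<in> generate W S" using cox by (simp add: coxeter_system_def)
  then show ?thesis
  proof induction
    case one
    then show ?case by (intro bexI[of _ "[]"]) auto
  next
    case (incl h)
    then show ?case by (intro bexI[of _ "[h]"]) (auto simp: gen_in)
  next
    case (inv h)
    then show ?case by (intro bexI[of _ "[h]"]) (auto simp: gen_in inv_gen)
  next
    case (eng h1 h2)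
    then obtain u v where "u \<in> lists S" "v \<in> lists S" "word_prod W u = h1" "word_prod W v = h2" by blast
    then show ?case by (intro bexI[of _ "u @ v"]) (auto simp: word_prod_append)
  qed
qed

text \<open>
  Since the generators are involutions, prepending generators reaches every element.
\<close>

lemma carrier_induct [consumes 1, case_names one gen]:
  assumes "w \<in> carrier W" "P \<one>" "\<And>s w. s \<in> S \<Longrightarrow> w \<in> carrier W \<Longrightarrow> P w \<Longrightarrow> P (s \<otimes> w)"
  shows "P w"
proof -
  obtain ws where "ws \<in> lists S" "word_prod W ws = w" using word_of assms by blast
  moreover have "ws \<in> lists S \<Longrightarrow> P (word_prod W ws)" for ws
    by (induction ws) (auto simp: assms word_prod_closed)
  ultimately show ?thesis by blast
qed

lemma countable_carrier: "countable (carrier W)"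
proof -
  have "carrier W \<subseteq> word_prod W ` lists S" using word_of by fastforce
  moreover have "countable (lists S)" using finS by (simp add: countable_finite)
  ultimately show ?thesis by (meson countable_image countable_subset)
qed

lemma group_action: "group_action W UNIV \<rho>" using act by (simp add: reflection_action_def)

lemma act_one [simp]: "\<rho> \<one> v = v"
  using group_action.id_eq_one[OF group_action] by (metis UNIV_I restrict_apply')

lemma act_mult: "x \<in> carrier W \<Longrightarrow> y \<in> carrier W \<Longrightarrow> \<rho> (x \<otimes> y) v = \<rho> x (\<rho> y v)"
  using group_action.composition_rule[OF group_action] by simp

lemma act_inv [simp]:
  assumes "w \<in> carrier W"
  shows "\<rho> (inv w) (\<rho> w v) = v" "\<rho> w (\<rho> (inv w) v) = v"
  using assms act_mult[of "inv w" w v] act_mult[of w "inv w" v] by auto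

lemma act_gen: "s \<in> S \<Longrightarrow> \<rho> s v = v - (2 * B v (\<alpha> s)) *\<^sub>R \<alpha> s"
  using act by (simp add: reflection_action_def)

lemmas B_simps = bilinear_ladd[OF bil] bilinear_radd[OF bil] bilinear_lsub[OF bil] bilinear_rsub[OF bil]
  bilinear_lmul[OF bil] bilinear_rmul[OF bil] bilinear_lneg[OF bil] bilinear_rneg[OF bil]
  bilinear_lzero[OF bil] bilinear_rzero[OF bil]

lemma B_sum_left: "B (\<Sum>i\<in>I. f i) y = (\<Sum>i\<in>I. B (f i) y)"
  using bil linear_sum[of "\<lambda>x. B x y"] by (simp add: bilinear_def)

lemma B_sum_right: "B y (\<Sum>i\<in>I. f i) = (\<Sum>i\<in>I. B y (f i))"
  using B_sum_left sym by simp

lemma B_simple_self: "s \<in> S \<Longrightarrow> B (\<alpha> s) (\<alpha> s) = 1"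
  using basis m_diag by (auto simp: root_basis_def one_enat_def)

lemma B_finite: "s \<in> S \<Longrightarrow> t \<in> S \<Longrightarrow> m s t = enat k \<Longrightarrow> B (\<alpha> s) (\<alpha> t) = - cos (pi / real k)"
  using basis by (auto simp: root_basis_def)

lemma B_infinite: "s \<in> S \<Longrightarrow> t \<in> S \<Longrightarrow> m s t = \<infinity> \<Longrightarrow> B (\<alpha> s) (\<alpha> t) \<le> - 1"
  using basis by (auto simp: root_basis_def)

text \<open>
  The root basis may take values below -1 where the standard form takes the value -1.
\<close>

lemma B_le_std: "s \<in> S \<Longrightarrow> t \<in> S \<Longrightarrow> B (\<alpha> s) (\<alpha> t) \<le> std_entry (m s t)"
  using B_finite B_infinite by (cases "m s t") (auto simp: std_entry_def)

lemma std_entry_nonpos: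
  assumes "2 \<le> k" shows "std_entry k \<le> 0"
proof (cases k)
  case (enat n)
  then have "2 \<le> n" using assms by (metis enat_ord_simps(1) numeral_eq_enat)
  then have "pi / real n \<le> pi / 2" by (intro divide_left_mono) auto
  moreover have "- (pi / 2) \<le> pi / real n" using pi_gt_zero by (smt (verit) divide_nonneg_nonneg of_nat_0_le_iff)
  ultimately have "0 \<le> cos (pi / real n)" by (intro cos_ge_zero)
  then show ?thesis using enat by (simp add: std_entry_def)
qed (simp add: std_entry_def)

lemma B_offdiag: "s \<in> S \<Longrightarrow> t \<in> S \<Longrightarrow> s \<noteq> t \<Longrightarrow> B (\<alpha> s) (\<alpha> t) \<le> 0"
  using B_le_std std_entry_nonpos m_ge2 by (meson order_trans)

lemma B_zero_imp_commute:
  assumes "s \<in> S" "t \<in> S" "s \<noteq> t" "B (\<alpha> s) (\<alpha> t) = 0"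
  shows "m s t = 2"
proof (cases "m s t")
  case (enat n)
  then have n: "2 \<le> n" using m_ge2[OF assms(1-3)] by (metis enat_ord_simps(1) numeral_eq_enat)
  have "cos (pi / real n) = 0" using B_finite[OF assms(1,2) enat] assms by simp
  moreover have "pi / real n \<le> pi" using n by (simp add: field_simps)
  ultimately have "pi / real n = pi / 2"
    using cos_inj_pi[of "pi / real n" "pi / 2"] by simp
  then have "n = 2" using n by (simp add: field_simps)
  then show ?thesis using enat by (simp add: numeral_eq_enat)
qed (use B_infinite assms in force)

lemma act_gen_self: "s \<in> S \<Longrightarrow> \<rho> s (\<alpha> s) = - \<alpha> s"
  by (simp add: act_gen B_simple_self scaleR_2)

lemma act_linear: "w \<in> carrier W \<Longrightarrow> linear (\<rho> w)"
proof (induction rule: carrier_induct)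
  case one
  have "\<rho> \<one> = (\<lambda>v. v)" by auto
  then show ?case by (simp add: linear_ident)
next
  case (gen s w)
  have "linear (\<rho> s)"
    by (rule linearI) (auto simp: act_gen[OF gen(1)] B_simps algebra_simps)
  then have "linear (\<rho> s \<circ> \<rho> w)" using gen by (intro linear_compose)
  moreover have "\<rho> (s \<otimes> w) = \<rho> s \<circ> \<rho> w" using gen by (auto simp: act_mult gen_in)
  ultimately show ?case by metis
qed

lemma act_isometry: "w \<in> carrier W \<Longrightarrow> B (\<rho> w u) (\<rho> w v) = B u v"
proof (induction rule: carrier_induct)
  case (gen s w)
  then show ?case
    by (simp add: act_mult gen_in act_gen B_simps B_simple_self sym[of "\<alpha> s" "\<rho> w v"] algebra_simps)
qed simp

lemmas act_simps = linear_add[OF act_linear] linear_diff[OF act_linear] linear_scale[OF act_linear]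
  linear_neg[OF act_linear] linear_0[OF act_linear] linear_sum[OF act_linear]

section \<open>Lengths and the signs of roots\<close>

definition nneg :: "'v \<Rightarrow> bool" where
  "nneg v \<longleftrightarrow> (\<exists>k. (\<forall>s\<in>S. 0 \<le> k s) \<and> v = (\<Sum>s\<in>S. k s *\<^sub>R \<alpha> s))"

lemma nneg_simple: "s \<in> S \<Longrightarrow> nneg (\<alpha> s)"
  unfolding nneg_def using finS
  by (intro exI[of _ "\<lambda>t. if t = s then 1 else 0"]) (auto simp: if_distrib[of "\<lambda>c. c *\<^sub>R _"] cong: if_cong)

lemma nneg_add: "nneg u \<Longrightarrow> nneg v \<Longrightarrow> nneg (u + v)"
  unfolding nneg_def by (clarify, rename_tac k l, rule_tac x = "\<lambda>s. k s + l s" in exI)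
    (auto simp: scaleR_add_left sum.distrib)

lemma nneg_scale: "nneg u \<Longrightarrow> 0 \<le> c \<Longrightarrow> nneg (c *\<^sub>R u)"
  unfolding nneg_def by (clarify, rename_tac k, rule_tac x = "\<lambda>s. c * k s" in exI)
    (auto simp: scaleR_sum_right)

definition len :: "'w \<Rightarrow> nat" where
  "len w = (LEAST n. \<exists>ws\<in>lists S. length ws = n \<and> word_prod W ws = w)"

lemma reduced_word: "w \<in> carrier W \<Longrightarrow> \<exists>ws\<in>lists S. length ws = len w \<and> word_prod W ws = w"
  unfolding len_def by (rule LeastI_ex) (use word_of in blast)

lemma len_le: "ws \<in> lists S \<Longrightarrow> len (word_prod W ws) \<le> length ws"
  unfolding len_def by (rule Least_le) blast

lemma cheb_dihedral_nonneg:
  assumes "s \<in> S" "t \<in> S" "s \<noteq> t" "enat j \<le> m s t"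
  shows "0 \<le> cheb (- B (\<alpha> s) (\<alpha> t)) j"
proof (cases "m s t")
  case (enat k)
  have k: "2 \<le> k" "j \<le> k"
    using m_ge2[OF assms(1-3)] assms(4) enat by (auto simp: numeral_eq_enat)
  have "cheb (cos (pi / real k)) j * sin (pi / real k) = sin (real j * (pi / real k))"
    by (rule cheb_cos)
  moreover have "0 < sin (pi / real k)"
    using k by (intro sin_gt_zero) (auto simp: field_simps)
  moreover have "0 \<le> sin (real j * (pi / real k))"
    using k by (intro sin_ge_zero) (auto simp: field_simps)
  ultimately have "0 \<le> cheb (cos (pi / real k)) j"
    by (metis mult_less_0_iff not_less)
  then show ?thesis using B_finite[OF assms(1,2) enat] by simp
next
  case infinity
  then show ?thesis using cheb_mono[of "- B (\<alpha> s) (\<alpha> t)" j] B_infinite[OF assms(1,2)] by simp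
qed

text \<open>
  Each letter advances the coordinate pair by one step of the recurrence; the recurrence starts
  from the simple root itself, whose coordinates are the numbers with index 1 and 0.
\<close>

lemma alternating_word_act:
  assumes "s \<in> S" "t \<in> S"
  defines "a \<equiv> - B (\<alpha> s) (\<alpha> t)"
  shows "\<exists>p\<in>{s,t}. \<exists>q\<in>{s,t}. \<rho> (word_prod W (alternating_word k s t)) (cheb a (Suc j) *\<^sub>R \<alpha> s + cheb a j *\<^sub>R \<alpha> t)
     = cheb a (Suc (j + k)) *\<^sub>R \<alpha> p + cheb a (j + k) *\<^sub>R \<alpha> q"
  using assms(1,2) unfolding a_def
proof (induction k arbitrary: j s t)
  case 0
  then show ?case by auto
next
  case (Suc k)
  let ?a = "- B (\<alpha> s) (\<alpha> t)"
  have in_lists: "alternating_word k t s \<in> lists S" using set_alternating_word[of k t s] Suc.prems by auto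
  have "\<rho> t (cheb ?a (Suc j) *\<^sub>R \<alpha> s + cheb ?a j *\<^sub>R \<alpha> t)
      = cheb ?a (Suc (Suc j)) *\<^sub>R \<alpha> t + cheb ?a (Suc j) *\<^sub>R \<alpha> s"
    using Suc.prems
    by (simp add: act_gen B_simps B_simple_self algebra_simps) (simp add: scaleR_add_left[symmetric] algebra_simps)
  moreover have "word_prod W (alternating_word (Suc k) s t) = word_prod W (alternating_word k t s) \<otimes> t"
    using Suc.prems in_lists by (simp add: word_prod_append gen_in)
  ultimately show ?case
    using Suc.IH[of t s "Suc j"] Suc.prems in_lists
    by (auto simp: act_mult gen_in word_prod_closed sym[of "\<alpha> t" "\<alpha> s"])
qed

lemma nneg_alternating:
  assumes "s \<in> S" "t \<in> S" "s \<noteq> t" "enat k < m s t"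
    and w: "w \<in> carrier W" and pos: "nneg (\<rho> w (\<alpha> s))" "nneg (\<rho> w (\<alpha> t))"
  shows "nneg (\<rho> (w \<otimes> word_prod W (alternating_word k s t)) (\<alpha> s))"
proof -
  let ?a = "- B (\<alpha> s) (\<alpha> t)"
  have in_lists: "alternating_word k s t \<in> lists S" using set_alternating_word[of k s t] assms by auto
  obtain p q where pq: "p \<in> {s, t}" "q \<in> {s, t}"
    "\<rho> (word_prod W (alternating_word k s t)) (\<alpha> s) = cheb ?a (Suc k) *\<^sub>R \<alpha> p + cheb ?a k *\<^sub>R \<alpha> q"
    using alternating_word_act[OF assms(1,2), of k 0] by auto
  have "enat (Suc k) \<le> m s t" "enat k \<le> m s t" using assms(4) by (auto simp: Suc_ile_eq)
  then have "0 \<le> cheb ?a (Suc k)" "0 \<le> cheb ?a k" using cheb_dihedral_nonneg assms(1-3) by blast+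
  moreover have "nneg (\<rho> w (\<alpha> p))" "nneg (\<rho> w (\<alpha> q))" using pq pos by auto
  ultimately have "nneg (cheb ?a (Suc k) *\<^sub>R \<rho> w (\<alpha> p) + cheb ?a k *\<^sub>R \<rho> w (\<alpha> q))"
    by (intro nneg_add nneg_scale)
  then show ?thesis using w in_lists by (simp add: act_mult word_prod_closed pq act_simps)
qed

lemma mult_gen_gen: "w \<in> carrier W \<Longrightarrow> s \<in> S \<Longrightarrow> w \<otimes> s \<otimes> s = w"
  by (simp add: m_assoc gen_in gen_sq)

text \<open>
  An alternating word of length n = m(s,t) that ends in t has the same value as a word of length n
  that ends in s: in the relator of length 2n the second half is the inverse of the first half, and
  the first half starts with s.
\<close>

lemma dihedral_exchange:
  assumes "s \<in> S" "t \<in> S" "m s t = enat n" "n \<le> k" "1 \<le> n"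
  shows "\<exists>z\<in>lists S. Suc (length z) = k \<and> word_prod W (alternating_word k s t) = word_prod W z \<otimes> s"
proof -
  have st: "{s, t} \<subseteq> S" using assms by auto
  obtain u where u: "alternating_word (n + n) s t = u @ alternating_word n s t" "length u = n" "set u \<subseteq> {s, t}"
    using alternating_word_add[of n n s t] by blast
  have "word_prod W (alternating_word (n + n) s t) = \<one>"
    using word_prod_relator[OF assms(1-3)] alternating_word_relator[of n s t] by (simp add: mult_2)
  have ul: "u \<in> lists S" "alternating_word n s t \<in> lists S" using u(3) st set_alternating_word[of n s t] by auto
  obtain u' where u': "u = s # u'"
  proof -
    obtain n' where n': "n = Suc n'" using assms(5) by (cases n) auto
    have "u @ alternating_word n s t = s # t # concat (replicate n' [s, t])"
      using u(1) alternating_word_relator[of n s t] n' by (simp add: mult_2)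
    moreover have "u \<noteq> []" using u(2) assms(5) by auto
    ultimately show ?thesis using that by (cases u) auto
  qed
  have invs: "word_prod W (rev v) = inv (word_prod W v)" if "v \<in> lists S" for v
    using that
  proof (induction v)
    case (Cons a v)
    then have "rev v \<in> lists S" by auto
    then show ?case using Cons
      by (simp add: word_prod_append gen_in inv_mult_group word_prod_closed inv_gen)
  qed simp
  have "word_prod W u \<otimes> word_prod W (alternating_word n s t) = \<one>"
    using \<open>word_prod W (alternating_word (n + n) s t) = \<one>\<close> u(1) ul by (simp add: word_prod_append)
  then have "word_prod W (alternating_word n s t) = inv (word_prod W u)"
    using ul by (metis inv_equality inv_inv inv_closed word_prod_closed)
  also have "\<dots> = word_prod W (rev u)" using invs ul by simp
  also have "\<dots> = word_prod W (rev u') \<otimes> s"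
    using u' ul assms(1) word_prod_append[of "rev u'" "[s]"] by (simp add: gen_in in_lists_conv_set)
  finally have eq: "word_prod W (alternating_word n s t) = word_prod W (rev u') \<otimes> s" .
  obtain v where v: "alternating_word ((k - n) + n) s t = v @ alternating_word n s t" "length v = k - n" "set v \<subseteq> {s, t}"
    using alternating_word_add[of "k - n" n s t] by blast
  have vl: "v \<in> lists S" "rev u' \<in> lists S" using v st ul u' by auto
  have "word_prod W (alternating_word k s t) = word_prod W (v @ rev u') \<otimes> s"
    using v(1) assms(4) eq vl ul assms(1) by (simp add: word_prod_append m_assoc word_prod_closed gen_in)
  then show ?thesis using vl u u' v assms(4) by (intro bexI[of _ "v @ rev u'"]) auto
qed

text \<open>
  Tits's argument. Take t such that w has a reduced word ending in t, and among all reduced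
  words of w of the form xy with y a word in s and t choose one with x as short as possible. By
  minimality neither s nor t shortens the value of x, so by induction that value maps \<open>\<alpha>\<^sub>s\<close> and \<open>\<alpha>\<^sub>t\<close> to
  nonnegative combinations. As s does not shorten w, the word y is alternating, does not end in s,
  and is shorter than m(s,t). Hence y maps \<open>\<alpha>\<^sub>s\<close> to a nonnegative combination of \<open>\<alpha>\<^sub>s\<close> and \<open>\<alpha>\<^sub>t\<close>.
\<close>

theorem nneg_of_ascent:
  assumes "w \<in> carrier W" "s \<in> S" "len w \<le> len (w \<otimes> s)"
  shows "nneg (\<rho> w (\<alpha> s))"
  using assms
proof (induction "len w" arbitrary: w s rule: less_induct)
  case less
  note w = less.prems(1) and s = less.prems(2) and ascent = less.prems(3)
  obtain ws where ws: "ws \<in> lists S" "length ws = len w" "word_prod W ws = w"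
    using reduced_word[OF w] by blast
  show ?case
  proof (cases ws rule: rev_cases)
    case Nil
    then show ?thesis using ws nneg_simple[OF s] by auto
  next
    case (snoc ws' t)
    have t: "t \<in> S" "ws' \<in> lists S" using ws snoc by auto
    have w_eq: "w = word_prod W ws' \<otimes> t" using ws t snoc by (auto simp: word_prod_append gen_in)
    have "t \<noteq> s"
    proof
      assume "t = s"
      then have "w \<otimes> s = word_prod W ws'" using w_eq t s by (simp add: mult_gen_gen word_prod_closed)
      then have "len (w \<otimes> s) \<le> length ws'" using len_le t by simp
      then show False using ascent ws snoc by simp
    qed
    define splits where "splits n \<longleftrightarrow> (\<exists>x y. x \<in> lists S \<and> y \<in> lists {s, t} \<and> length x = n
        \<and> word_prod W (x @ y) = w \<and> length (x @ y) = len w)" for n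
    have "splits (length ws')"
      unfolding splits_def using t ws snoc by (intro exI[of _ ws'] exI[of _ "[t]"]) auto
    define n where "n = (LEAST n. splits n)"
    have n: "splits n" "n \<le> length ws'" and n_least: "\<And>k. splits k \<Longrightarrow> n \<le> k"
      unfolding n_def using \<open>splits (length ws')\<close> by (auto intro: LeastI Least_le)
    obtain x y where x: "x \<in> lists S" "length x = n" and y: "y \<in> lists {s, t}"
      and xy: "word_prod W (x @ y) = w" "length (x @ y) = len w"
      using n unfolding splits_def by blast
    have yS: "y \<in> lists S" using y s t by auto
    let ?v = "word_prod W x"
    have v: "?v \<in> carrier W" using x by (simp add: word_prod_closed)
    have shorter: False if "zs \<in> lists S" "word_prod W zs = w" "length zs < len w" for zs
      using len_le[OF that(1)] that by simp
    have "len ?v \<le> length x" using len_le x by blast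
    have lt: "len ?v < len w" using \<open>len ?v \<le> length x\<close> n(2) x ws snoc by simp
    have asc: "nneg (\<rho> ?v (\<alpha> p))" if p: "p \<in> {s, t}" for p
    proof (rule less.hyps[OF lt v])
      show "p \<in> S" using p s t by auto
      show "len ?v \<le> len (?v \<otimes> p)"
      proof (rule ccontr)
        assume "\<not> ?thesis"
        then have l: "len (?v \<otimes> p) < length x" using \<open>len ?v \<le> length x\<close> by simp
        obtain x' where x': "x' \<in> lists S" "length x' = len (?v \<otimes> p)" "word_prod W x' = ?v \<otimes> p"
          using reduced_word[of "?v \<otimes> p"] v gen_in \<open>p \<in> S\<close> by auto
        have e: "word_prod W (x' @ p # y) = w"
          using x' v \<open>p \<in> S\<close> yS xy x
          by (simp add: word_prod_append gen_in word_prod_closed m_assoc[symmetric] mult_gen_gen)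
        have "length (x' @ p # y) \<le> length (x @ y)" using l x' by simp
        moreover have "\<not> length (x' @ p # y) < len w" using shorter[OF _ e] x' \<open>p \<in> S\<close> yS by auto
        ultimately have "length (x' @ p # y) = len w" using xy by simp
        then have "splits (length x')" unfolding splits_def using e x' p y
          by (intro exI[of _ x'] exI[of _ "p # y"]) auto
        then show False using n_least l x' x by fastforce
      qed
    qed
    have dist: "distinct_adj y"
    proof (rule ccontr)
      assume "\<not> ?thesis"
      then obtain y1 p y2 where y12: "y = y1 @ p # p # y2" using not_distinct_adj by blast
      have l: "y1 \<in> lists S" "y2 \<in> lists S" "p \<in> S" using yS y12 by auto
      then have "word_prod W y = word_prod W (y1 @ y2)"
        using y12 by (simp add: word_prod_append word_prod_closed gen_in m_assoc[symmetric] gen_sq)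
      then have "word_prod W (x @ y1 @ y2) = w" using xy x l yS by (simp add: word_prod_append)
      then show False using shorter[of "x @ y1 @ y2"] xy y12 x l by simp
    qed
    have no_s: False if "z \<in> lists S" "word_prod W z \<otimes> s = w" "Suc (length z) = len w" for z
    proof -
      have "w \<otimes> s = word_prod W z" using that s mult_gen_gen[of "word_prod W z" s] by (simp add: word_prod_closed)
      then show False using len_le[OF that(1)] ascent that by simp
    qed
    have "y = [] \<or> last y = t"
    proof (rule ccontr)
      assume *: "\<not> ?thesis"
      then have "last y = s" using y last_in_set[of y] by auto
      then have "y = butlast y @ [s]" using * append_butlast_last_id by metis
      then obtain y' where y': "y = y' @ [s]" by blast
      then have "word_prod W (x @ y') \<otimes> s = w" using xy x yS s
        by (simp add: word_prod_append gen_in word_prod_closed m_assoc)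
      then show False using no_s[of "x @ y'"] xy y' yS x by simp
    qed
    then have y_alt: "y = alternating_word (length y) s t" using alternating_word_unique[OF dist] y by auto
    have "enat (length y) < m s t"
    proof (rule ccontr)
      assume "\<not> ?thesis"
      then obtain k where k: "m s t = enat k" "k \<le> length y" by (cases "m s t") auto
      have "1 \<le> k" using m_ge2[OF s t(1)] \<open>t \<noteq> s\<close> k by (auto simp: numeral_eq_enat)
      from dihedral_exchange[OF s t(1) k this] y_alt obtain z where
        z: "z \<in> lists S" "Suc (length z) = length y" "word_prod W y = word_prod W z \<otimes> s" by auto
      have "word_prod W (x @ z) \<otimes> s = w" using xy x yS s z
        by (simp add: word_prod_append gen_in word_prod_closed m_assoc)
      then show False using no_s[of "x @ z"] xy x z by simp
    qed
    then have "nneg (\<rho> (?v \<otimes> word_prod W (alternating_word (length y) s t)) (\<alpha> s))"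
      using s t \<open>t \<noteq> s\<close> v asc by (intro nneg_alternating) auto
    then show ?thesis using y_alt xy x yS by (simp add: word_prod_append)
  qed
qed

text \<open>
  If s shortens w, then it does not shorten \<open>w s\<close>, and s maps \<open>\<alpha>\<^sub>s\<close> to its negative.
\<close>

lemma nneg_of_descent:
  assumes "w \<in> carrier W" "s \<in> S" "len (w \<otimes> s) < len w"
  shows "nneg (- \<rho> w (\<alpha> s))"
proof -
  have ws: "w \<otimes> s \<in> carrier W" using assms gen_in by simp
  have "nneg (\<rho> (w \<otimes> s) (\<alpha> s))"
    by (rule nneg_of_ascent[OF ws assms(2)]) (use assms in \<open>simp add: mult_gen_gen\<close>)
  then show ?thesis using assms by (simp add: act_mult gen_in act_gen_self act_simps)
qed

lemma ex_descent:
  assumes "w \<in> carrier W" "w \<noteq> \<one>"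
  shows "\<exists>s\<in>S. len (w \<otimes> s) < len w"
proof -
  obtain ws where ws: "ws \<in> lists S" "length ws = len w" "word_prod W ws = w"
    using reduced_word[OF assms(1)] by blast
  then have "ws \<noteq> []" using assms by auto
  then obtain ws' s where s: "ws = ws' @ [s]" by (metis append_butlast_last_id)
  then have "w \<otimes> s = word_prod W ws'"
    using ws mult_gen_gen[of "word_prod W ws'" s] by (auto simp: word_prod_append gen_in word_prod_closed)
  then show ?thesis using len_le[of ws'] ws s by (intro bexI[of _ s]) auto
qed

abbreviation roots_W :: "'v set" ("\<Phi>") where "\<Phi> \<equiv> roots W S \<alpha> \<rho>"

lemma simple_root: "s \<in> S \<Longrightarrow> \<alpha> s \<in> \<Phi>"
  unfolding roots_def using act_one[of "\<alpha> s"] by force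

lemma root_act: "w \<in> carrier W \<Longrightarrow> \<beta> \<in> \<Phi> \<Longrightarrow> \<rho> w \<beta> \<in> \<Phi>"
  unfolding roots_def using act_mult by (smt (verit) mem_Collect_eq m_closed)

lemma root_uminus: "\<beta> \<in> \<Phi> \<Longrightarrow> - \<beta> \<in> \<Phi>"
proof -
  assume "\<beta> \<in> \<Phi>"
  then obtain w s where "w \<in> carrier W" "s \<in> S" "\<beta> = \<rho> w (\<alpha> s)" by (auto simp: roots_def)
  then show ?thesis
    using root_act[OF _ root_act[OF gen_in simple_root], of w s s] by (simp add: act_gen_self act_simps)
qed

lemma root_self: "\<beta> \<in> \<Phi> \<Longrightarrow> B \<beta> \<beta> = 1"
  by (auto simp: roots_def act_isometry B_simple_self)

lemma root_sign: "\<beta> \<in> \<Phi> \<Longrightarrow> nneg \<beta> \<or> nneg (- \<beta>)"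
  unfolding roots_def using nneg_of_ascent nneg_of_descent by (fastforce simp: not_less)

text \<open>
  The reflection in the root \<open>w \<alpha>\<^sub>s\<close> is the conjugate of s by w.
\<close>

lemma root_reflection:
  assumes "\<beta> \<in> \<Phi>"
  shows "\<exists>r\<in>carrier W. \<forall>v. \<rho> r v = v - (2 * B v \<beta>) *\<^sub>R \<beta>"
proof -
  obtain w s where w: "w \<in> carrier W" "s \<in> S" "\<beta> = \<rho> w (\<alpha> s)" using assms by (auto simp: roots_def)
  have "\<rho> (w \<otimes> s \<otimes> inv w) v = v - (2 * B v \<beta>) *\<^sub>R \<beta>" for v
  proof -
    have "B (\<rho> (inv w) v) (\<alpha> s) = B v \<beta>"
      using act_isometry[OF w(1), of "\<rho> (inv w) v" "\<alpha> s"] w by simp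
    then show ?thesis using w by (simp add: act_mult gen_in act_gen act_simps)
  qed
  then show ?thesis using w by (intro bexI[of _ "w \<otimes> s \<otimes> inv w"]) (auto simp: gen_in)
qed

definition root_refl :: "'v \<Rightarrow> 'w" where
  "root_refl \<beta> = (SOME r. r \<in> carrier W \<and> (\<forall>v. \<rho> r v = v - (2 * B v \<beta>) *\<^sub>R \<beta>))"

lemma root_refl:
  assumes "\<beta> \<in> \<Phi>"
  shows "root_refl \<beta> \<in> carrier W" "\<rho> (root_refl \<beta>) v = v - (2 * B v \<beta>) *\<^sub>R \<beta>"
  using someI_ex[OF root_reflection[OF assms, unfolded Bex_def]] unfolding root_refl_def by auto

lemma pos_roots_eq: "pos_roots W S \<alpha> \<rho> = {\<beta> \<in> \<Phi>. nneg \<beta>}"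
  by (simp add: pos_roots_def nneg_def)

lemma countable_roots: "countable \<Phi>"
proof -
  have "\<Phi> = (\<lambda>(w, s). \<rho> w (\<alpha> s)) ` (carrier W \<times> S)" by (auto simp: roots_def)
  then show ?thesis using countable_carrier finS by (simp add: countable_finite)
qed

lemma combination_span: "(\<Sum>s\<in>S. k s *\<^sub>R \<alpha> s) \<in> span (\<alpha> ` S)"
  by (intro span_sum span_scale span_base imageI)

lemma nneg_span: "nneg v \<Longrightarrow> v \<in> span (\<alpha> ` S)"
  unfolding nneg_def using combination_span by auto

lemma root_span: "\<beta> \<in> \<Phi> \<Longrightarrow> \<beta> \<in> span (\<alpha> ` S)"
  using root_sign nneg_span span_neg by (metis minus_minus)

section \<open>Positive definite forms\<close>

text \<open>
  Along a reduced word of w each letter subtracts a nonnegative multiple of a nonnegative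
  combination from v.
\<close>

lemma nneg_diff_dominant:
  assumes dom: "\<And>s. s \<in> S \<Longrightarrow> 0 \<le> B v (\<alpha> s)" and "w \<in> carrier W"
  shows "nneg (v - \<rho> w v)"
  using assms(2)
proof (induction "len w" arbitrary: w rule: less_induct)
  case less
  show ?case
  proof (cases "w = \<one>")
    case True
    then show ?thesis unfolding nneg_def by (intro exI[of _ "\<lambda>_. 0"]) simp
  next
    case False
    then obtain s where s: "s \<in> S" "len (w \<otimes> s) < len w" using ex_descent less.prems by blast
    let ?u = "w \<otimes> s"
    have u: "?u \<in> carrier W" "w = ?u \<otimes> s" using s less.prems by (auto simp: gen_in mult_gen_gen)
    have "nneg (\<rho> ?u (\<alpha> s))" using nneg_of_ascent[OF u(1) s(1)] s u by simp
    then have "nneg ((v - \<rho> ?u v) + (2 * B v (\<alpha> s)) *\<^sub>R \<rho> ?u (\<alpha> s))"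
      using less.hyps[OF s(2) u(1)] dom[OF s(1)] by (intro nneg_add nneg_scale) auto
    moreover have "\<rho> w v = \<rho> ?u v - (2 * B v (\<alpha> s)) *\<^sub>R \<rho> ?u (\<alpha> s)"
      by (subst u(2), subst act_mult) (use u s in \<open>simp_all add: gen_in act_gen act_simps\<close>)
    ultimately show ?thesis by (simp only: diff_diff_eq2 diff_add_eq)
  qed
qed

lemma B_combination:
  "B (\<Sum>s\<in>S. x s *\<^sub>R \<alpha> s) v = (\<Sum>s\<in>S. x s * B (\<alpha> s) v)"
  "B v (\<Sum>s\<in>S. x s *\<^sub>R \<alpha> s) = (\<Sum>s\<in>S. x s * B v (\<alpha> s))"
  by (simp_all add: B_sum_left B_sum_right B_simps)

text \<open>
  An infinite entry m(s,t) would make \<open>e\<^sub>s + e\<^sub>t\<close> isotropic for the standard form.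
\<close>

lemma finite_entries_of_pos_def:
  assumes "std_pos_def S m" "s \<in> S" "t \<in> S"
  shows "m s t \<noteq> \<infinity>"
proof
  assume inf: "m s t = \<infinity>"
  then have ne: "s \<noteq> t" using m_diag assms by auto
  define x where "x u = (if u = s \<or> u = t then 1 else 0::real)" for u
  have "std_form S m x x = (\<Sum>u\<in>S. \<Sum>v\<in>{s, t}. x u * x v * std_entry (m u v))"
    unfolding std_form_def
    by (intro sum.cong refl sum.mono_neutral_right) (use assms finS in \<open>auto simp: x_def\<close>)
  also have "\<dots> = (\<Sum>u\<in>{s, t}. \<Sum>v\<in>{s, t}. x u * x v * std_entry (m u v))"
    by (intro sum.mono_neutral_right) (use assms finS in \<open>auto simp: x_def\<close>)
  also have "\<dots> = 0"
    using ne inf m_sym[of s t] assms m_diag by (simp add: x_def std_entry_def one_enat_def)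
  finally have "std_form S m x x = 0" .
  moreover have "x s \<noteq> 0" by (simp add: x_def)
  ultimately show False using assms unfolding std_pos_def_def by (metis less_irrefl)
qed

text \<open>
  Choose v with \<open>B v \<alpha>\<^sub>s > 0\<close> for all s. Writing \<open>w v = v - \<Sum>\<^sub>s k\<^sub>s \<alpha>\<^sub>s\<close> with \<open>k\<^sub>s \<ge> 0\<close>, the inequality
  \<open>B v (w v) \<ge> - B v v\<close> bounds the coefficients uniformly in w. On the other hand distinct elements w
  and w' have coefficients that differ by a fixed amount: some root \<open>w' \<alpha>\<^sub>s\<close> separates \<open>w v\<close> from \<open>w' v\<close>,
  since v lies in the open fundamental chamber and \<open>w'\<^sup>-\<^sup>1 w v\<close> does not. So the coefficients, rounded
  to a fine enough grid, determine w, and there are only finitely many rounded values.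
\<close>

lemma finite_of_pos_def:
  assumes pd: "std_pos_def S m"
  shows "finite (carrier W)"
proof -
  have std: "B (\<alpha> s) (\<alpha> t) = std_entry (m s t)" if "s \<in> S" "t \<in> S" for s t
    using finite_entries_of_pos_def[OF pd that] B_finite[OF that] by (auto simp: std_entry_def)
  \<comment> \<open>all entries are finite, so B is given by the standard matrix\<close>
  have form: "B (\<Sum>s\<in>S. x s *\<^sub>R \<alpha> s) (\<Sum>s\<in>S. x s *\<^sub>R \<alpha> s) = std_form S m x x" for x
    unfolding std_form_def
    by (subst B_combination(1), subst B_combination(2)) (auto simp: std sum_distrib_left mult_ac intro!: sum.cong)
  have psd: "0 \<le> B u u" if u: "u \<in> span (\<alpha> ` S)" for u
  proof -
    obtain x where "u = (\<Sum>s\<in>S. x s *\<^sub>R \<alpha> s)"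
    proof -
      have "inj_on \<alpha> S" using basis by (simp add: root_basis_def)
      obtain y where "u = (\<Sum>a\<in>\<alpha> ` S. y a *\<^sub>R a)"
        using u finS by (auto simp: span_finite)
      also have "\<dots> = (\<Sum>s\<in>S. y (\<alpha> s) *\<^sub>R \<alpha> s)" using \<open>inj_on \<alpha> S\<close> by (simp add: sum.reindex)
      finally show ?thesis by (rule that)
    qed
    moreover have "0 \<le> std_form S m x x"
    proof (cases "\<exists>s\<in>S. x s \<noteq> 0")
      case True
      then show ?thesis using pd by (auto simp: std_pos_def_def less_imp_le)
    next
      case False
      then show ?thesis by (simp add: std_form_def)
    qed
    ultimately show ?thesis using form by simp
  qed
  have "\<exists>x. \<forall>s\<in>S. 0 < (\<Sum>t\<in>S. x t * B (\<alpha> s) (\<alpha> t))"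
  proof (rule gordan[OF finS finS])
    fix k assume k: "\<forall>t\<in>S. (\<Sum>i\<in>S. k i * B (\<alpha> i) (\<alpha> t)) = 0"
    have "std_form S m k k = 0"
      unfolding form[symmetric] by (subst B_combination(2), subst B_combination(1)) (simp add: k)
    then show "\<forall>i\<in>S. k i = 0" using pd by (auto simp: std_pos_def_def)
  qed
  then obtain x where x: "\<forall>s\<in>S. 0 < (\<Sum>t\<in>S. x t * B (\<alpha> s) (\<alpha> t))" by blast
  define v where "v = (\<Sum>t\<in>S. x t *\<^sub>R \<alpha> t)"
  have v: "0 < B v (\<alpha> s)" if "s \<in> S" for s
    using x that unfolding v_def by (subst sym) (simp add: B_combination)
  have v_span: "v \<in> span (\<alpha> ` S)"
    unfolding v_def by (rule combination_span)
  define e where "e = Min (insert 1 ((\<lambda>s. B v (\<alpha> s)) ` S))"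
  have e: "0 < e" "\<And>s. s \<in> S \<Longrightarrow> e \<le> B v (\<alpha> s)"
    unfolding e_def using finS v by (auto simp: Min_le_iff)
  have "\<forall>w\<in>carrier W. \<exists>k. (\<forall>s\<in>S. 0 \<le> k s) \<and> v - \<rho> w v = (\<Sum>s\<in>S. k s *\<^sub>R \<alpha> s)"
    using nneg_diff_dominant[of v] v unfolding nneg_def by (simp add: less_imp_le)
  then obtain k where k: "\<And>w s. w \<in> carrier W \<Longrightarrow> s \<in> S \<Longrightarrow> 0 \<le> k w s"
    "\<And>w. w \<in> carrier W \<Longrightarrow> v - \<rho> w v = (\<Sum>s\<in>S. k w s *\<^sub>R \<alpha> s)"
    by metis
  have k_bound: "k w s \<le> 2 * B v v / B v (\<alpha> s)" if w: "w \<in> carrier W" and s: "s \<in> S" for w s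
  proof -
    have wv: "\<rho> w v = v - (\<Sum>s\<in>S. k w s *\<^sub>R \<alpha> s)" using k(2)[OF w] by (simp add: algebra_simps)
    then have "\<rho> w v + v \<in> span (\<alpha> ` S)"
      using v_span combination_span by (auto intro!: span_add span_diff)
    then have "0 \<le> B (\<rho> w v + v) (\<rho> w v + v)" by (rule psd)
    also have "\<dots> = 2 * B v v + 2 * B v (\<rho> w v)"
      using act_isometry[OF w, of v v] by (simp add: B_simps sym[of "\<rho> w v" v])
    also have "B v (\<rho> w v) = B v v - (\<Sum>s\<in>S. k w s * B v (\<alpha> s))"
      by (subst wv) (simp add: B_simps B_combination)
    finally have "(\<Sum>s\<in>S. k w s * B v (\<alpha> s)) \<le> 2 * B v v" by simp
    moreover have "k w s * B v (\<alpha> s) \<le> (\<Sum>s\<in>S. k w s * B v (\<alpha> s))"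
      using s finS k(1)[OF w] v by (intro member_le_sum) (auto simp: less_imp_le)
    ultimately show ?thesis using v[OF s] by (simp add: field_simps)
  qed
  \<comment> \<open>a difference of less than \<open>1 / N\<close> in each coefficient moves the product with a root by less than e\<close>
  define N where "N = real (card S) / e"
  define F where "F w = (\<lambda>s\<in>S. \<lfloor>N * k w s\<rfloor>)" for w
  have "N \<ge> 0" using e by (simp add: N_def)
  have "F w \<in> Pi\<^sub>E S (\<lambda>s. {0..\<lfloor>N * (2 * B v v / B v (\<alpha> s))\<rfloor>})" if "w \<in> carrier W" for w
    using k(1)[OF that] k_bound[OF that] \<open>N \<ge> 0\<close>
    by (auto simp: F_def simp del: times_divide_eq_right intro!: floor_mono mult_left_mono)
  then have "F ` carrier W \<subseteq> Pi\<^sub>E S (\<lambda>s. {0..\<lfloor>N * (2 * B v v / B v (\<alpha> s))\<rfloor>})" by blast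
  moreover have "finite (Pi\<^sub>E S (\<lambda>s. {0..\<lfloor>N * (2 * B v v / B v (\<alpha> s))\<rfloor>}))"
    by (intro finite_PiE finS) auto
  ultimately have "finite (F ` carrier W)" by (rule finite_subset)
  moreover have "inj_on F (carrier W)"
  proof (rule inj_onI, rule ccontr)
    fix w w' assume w: "w \<in> carrier W" "w' \<in> carrier W" and F: "F w = F w'" and ne: "w \<noteq> w'"
    \<comment> \<open>a descent s of the inverse of u gives a wall of the fundamental chamber that u moves v across\<close>
    define u where "u = inv w' \<otimes> w"
    have u: "u \<in> carrier W" "w = w' \<otimes> u" using w by (auto simp: u_def m_assoc[symmetric])
    then have "inv u \<noteq> \<one>" using ne w by auto
    then obtain s where s: "s \<in> S" "len (inv u \<otimes> s) < len (inv u)" using ex_descent[of "inv u"] u by auto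
    have "nneg (- \<rho> (inv u) (\<alpha> s))" using nneg_of_descent[OF _ s] u by simp
    then obtain l where l: "\<forall>t\<in>S. 0 \<le> l t" "- \<rho> (inv u) (\<alpha> s) = (\<Sum>t\<in>S. l t *\<^sub>R \<alpha> t)"
      unfolding nneg_def by blast
    have "0 \<le> B v (- \<rho> (inv u) (\<alpha> s))"
      unfolding l(2) B_combination using l(1) v by (intro sum_nonneg) (auto simp: less_imp_le)
    then have "B v (\<rho> (inv u) (\<alpha> s)) \<le> 0" by (simp add: B_simps)
    then have "B (\<rho> u v) (\<alpha> s) \<le> 0"
      using act_isometry[OF u(1), of v "\<rho> (inv u) (\<alpha> s)"] u by simp
    then have "B (\<rho> u v - v) (\<alpha> s) \<le> - e" using e(2)[OF s(1)] by (simp add: B_simps)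
    moreover have "\<rho> w v - \<rho> w' v = \<rho> w' (\<rho> u v - v)" using u w by (simp add: act_mult act_simps)
    ultimately have le: "B (\<rho> w v - \<rho> w' v) (\<rho> w' (\<alpha> s)) \<le> - e" using act_isometry w by simp
    let ?\<gamma> = "\<rho> w' (\<alpha> s)"
    have \<gamma>: "?\<gamma> \<in> \<Phi>" using w s root_act simple_root by blast
    have "\<rho> w v - \<rho> w' v = (\<Sum>t\<in>S. (k w' t - k w t) *\<^sub>R \<alpha> t)"
      using k(2)[OF w(1)] k(2)[OF w(2)]
      by (simp add: scaleR_diff_left sum_subtractf algebra_simps)
    then have "e \<le> - (\<Sum>t\<in>S. (k w' t - k w t) * B (\<alpha> t) ?\<gamma>)"
      using le by (simp add: B_combination)
    also have "\<dots> \<le> (\<Sum>t\<in>S. \<bar>k w' t - k w t\<bar>)"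
      unfolding sum_negf[symmetric]
    proof (rule sum_mono)
      fix t assume t: "t \<in> S"
      have "?\<gamma> \<in> span (\<alpha> ` S)" "\<alpha> t \<in> span (\<alpha> ` S)" using \<gamma> t root_span simple_root by auto
      then have "0 \<le> B (\<alpha> t + ?\<gamma>) (\<alpha> t + ?\<gamma>)" "0 \<le> B (\<alpha> t - ?\<gamma>) (\<alpha> t - ?\<gamma>)"
        by (auto intro!: psd span_add span_diff)
      then have "\<bar>B (\<alpha> t) ?\<gamma>\<bar> \<le> 1"
        using root_self[OF \<gamma>] B_simple_self[OF t] by (simp add: B_simps sym[of ?\<gamma> "\<alpha> t"])
      then have "\<bar>k w' t - k w t\<bar> * \<bar>B (\<alpha> t) ?\<gamma>\<bar> \<le> \<bar>k w' t - k w t\<bar> * 1"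
        by (intro mult_left_mono) auto
      then show "- ((k w' t - k w t) * B (\<alpha> t) ?\<gamma>) \<le> \<bar>k w' t - k w t\<bar>"
        by (simp add: abs_mult[symmetric])
    qed
    finally have "e \<le> (\<Sum>t\<in>S. \<bar>k w' t - k w t\<bar>)" .
    also have "\<dots> < (\<Sum>t\<in>S. e / real (card S))"
    proof (rule sum_strict_mono)
      fix t assume t: "t \<in> S"
      then have c: "0 < real (card S)" using finS card_gt_0_iff by force
      have "\<lfloor>N * k w t\<rfloor> = \<lfloor>N * k w' t\<rfloor>" using F t unfolding F_def by (metis restrict_apply')
      then have "\<bar>N * k w' t - N * k w t\<bar> < 1" by linarith
      also have "N * k w' t - N * k w t = N * (k w' t - k w t)" by (simp add: algebra_simps)
      finally have "N * \<bar>k w' t - k w t\<bar> < 1" using \<open>N \<ge> 0\<close> by (simp add: abs_mult)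
      then show "\<bar>k w' t - k w t\<bar> < e / real (card S)" using c e by (simp add: N_def field_simps)
    qed (use finS s in auto)
    also have "\<dots> = e" using s finS by auto
    finally show False by simp
  qed
  ultimately show ?thesis by (rule finite_imageD)
qed

section \<open>Indefinite forms\<close>

text \<open>
  With A the standard matrix and y a positive vector, the form \<open>\<Sum> a\<^sub>s\<^sub>t x\<^sub>s x\<^sub>t\<close> equals
  \<open>\<Sum>\<^sub>s (A y)\<^sub>s x\<^sub>s\<^sup>2 / y\<^sub>s - \<Sum> a\<^sub>s\<^sub>t y\<^sub>s y\<^sub>t (x\<^sub>s / y\<^sub>s - x\<^sub>t / y\<^sub>t)\<^sup>2 / 2\<close>, and the off-diagonal entries are nonpositive.
  The proof compares the two sides term by term.
\<close>

lemma psd_of_subharmonic: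
  assumes y: "\<And>s. s \<in> S \<Longrightarrow> 0 < y s" "\<And>t. t \<in> S \<Longrightarrow> 0 \<le> (\<Sum>s\<in>S. y s * std_entry (m t s))"
  shows "std_pos_semidef S m"
  unfolding std_pos_semidef_def
proof
  fix x
  let ?a = "\<lambda>s t. std_entry (m s t)"
  let ?g = "\<lambda>s t. (x s)\<^sup>2 / y s * (y t * ?a s t)"
  have pt: "(?g s t + ?g t s) / 2 \<le> x s * x t * ?a s t" if st: "s \<in> S" "t \<in> S" for s t
  proof (cases "s = t")
    case True
    then show ?thesis using y(1)[OF st(1)] by (simp add: power2_eq_square)
  next
    case False
    have a: "?a s t \<le> 0" "?a t s = ?a s t" using std_entry_nonpos m_ge2 m_sym st False by auto
    have ys: "0 < y s" "0 < y t" using y(1) st by auto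
    have "0 \<le> (x s * y t - x t * y s)\<^sup>2" by simp
    then have "2 * (x s * x t) * (y s * y t) \<le> (x s)\<^sup>2 * (y t)\<^sup>2 + (x t)\<^sup>2 * (y s)\<^sup>2"
      by (simp add: power2_diff power_mult_distrib algebra_simps)
    then have "x s * x t \<le> ((x s)\<^sup>2 / y s * y t + (x t)\<^sup>2 / y t * y s) / 2"
      using ys by (simp add: field_simps power2_eq_square)
    from mult_right_mono_neg[OF this a(1)]
    show ?thesis using a(2) by (simp add: algebra_simps add_divide_distrib)
  qed
  have "0 \<le> (\<Sum>s\<in>S. (x s)\<^sup>2 / y s * (\<Sum>t\<in>S. y t * ?a s t))"
  proof (rule sum_nonneg)
    fix s assume s: "s \<in> S"
    show "0 \<le> (x s)\<^sup>2 / y s * (\<Sum>t\<in>S. y t * ?a s t)"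
      using y(1)[OF s] y(2)[OF s] by (intro mult_nonneg_nonneg) (auto simp: less_imp_le)
  qed
  also have "\<dots> = (\<Sum>s\<in>S. \<Sum>t\<in>S. ?g s t)" by (simp add: sum_distrib_left)
  also have "\<dots> = ((\<Sum>s\<in>S. \<Sum>t\<in>S. ?g s t) + (\<Sum>s\<in>S. \<Sum>t\<in>S. ?g t s)) / 2"
    by (subst (3) sum.swap) simp
  also have "\<dots> = (\<Sum>s\<in>S. \<Sum>t\<in>S. (?g s t + ?g t s) / 2)"
    by (simp only: sum.distrib[symmetric] sum_divide_distrib)
  also have "\<dots> \<le> std_form S m x x"
    unfolding std_form_def by (intro sum_mono pt)
  finally show "0 \<le> std_form S m x x" .
qed

text \<open>
  Gordan's theorem is applied to the rows of \<open>- A\<close> and of the identity matrix, where A is the Gram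
  matrix of the simple roots. If there is no such x, it produces a nonzero \<open>y \<ge> 0\<close> with \<open>A y \<ge> 0\<close>.
  By irreducibility y has no zero coordinate, and then the standard form is positive
  semidefinite, because its entries are at least those of A.
\<close>

lemma ex_negative_vector:
  assumes irr: "irreducible_coxeter S m" and nonpsd: "\<not> std_pos_semidef S m"
  shows "\<exists>x. (\<forall>s\<in>S. 0 < x s) \<and> (\<forall>s\<in>S. B (\<Sum>t\<in>S. x t *\<^sub>R \<alpha> t) (\<alpha> s) < 0)"
proof -
  define M :: "'w + 'w \<Rightarrow> 'w \<Rightarrow> real" where
    "M i t = (case i of Inl s \<Rightarrow> - B (\<alpha> s) (\<alpha> t) | Inr s \<Rightarrow> if t = s then 1 else 0)" for i t
  have "\<exists>x. \<forall>i\<in>S <+> S. 0 < (\<Sum>t\<in>S. x t * M i t)"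
  proof (rule gordan)
    fix k assume k: "\<forall>i\<in>S <+> S. 0 \<le> k i" "\<forall>t\<in>S. (\<Sum>i\<in>S <+> S. k i * M i t) = 0"
    define y where "y = k \<circ> Inl"
    define z where "z = k \<circ> Inr"
    have yz: "0 \<le> y s" "0 \<le> z s" if "s \<in> S" for s using k that by (auto simp: y_def z_def)
    have z: "z t = (\<Sum>s\<in>S. y s * B (\<alpha> s) (\<alpha> t))" if t: "t \<in> S" for t
    proof -
      have "0 = (\<Sum>s\<in>S. y s * - B (\<alpha> s) (\<alpha> t)) + (\<Sum>s\<in>S. if t = s then z s else 0)"
        using k(2) t finS by (simp add: sum.Plus M_def y_def z_def o_def if_distrib cong: if_cong)
      then show ?thesis using t finS by (simp add: sum_negf)
    qed
    have "y s = 0" if "s \<in> S" for s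
    proof (rule ccontr)
      assume "y s \<noteq> 0"
      define J where "J = {t \<in> S. y t = 0}"
      have "J = {}"
      proof (rule ccontr)
        assume J: "J \<noteq> {}"
        have J_sub: "J \<subset> S" using \<open>y s \<noteq> 0\<close> that by (auto simp: J_def)
        have "m t u = 2" if t: "t \<in> J" and u: "u \<in> S - J" for t u
        proof -
          have tu: "t \<in> S" "u \<in> S" "t \<noteq> u" "y t = 0" "y u \<noteq> 0" using t u by (auto simp: J_def)
          have "0 \<le> (\<Sum>s\<in>S. y s * B (\<alpha> s) (\<alpha> t))" using z yz tu by metis
          moreover have np: "y s * B (\<alpha> s) (\<alpha> t) \<le> 0" if "s \<in> S" for s
            using tu yz(1)[OF that] B_offdiag[OF that tu(1)] by (cases "s = t") (auto simp: mult_nonneg_nonpos)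
          ultimately have "(\<Sum>s\<in>S. - (y s * B (\<alpha> s) (\<alpha> t))) = 0"
            using sum_nonneg[of S "\<lambda>s. - (y s * B (\<alpha> s) (\<alpha> t))"] by (simp add: sum_negf)
          then have "\<forall>s\<in>S. - (y s * B (\<alpha> s) (\<alpha> t)) = 0"
            using np by (subst (asm) sum_nonneg_eq_0_iff) (auto simp: finS)
          then have "B (\<alpha> t) (\<alpha> u) = 0" using tu sym[of "\<alpha> t" "\<alpha> u"] by auto
          then show ?thesis using B_zero_imp_commute tu by blast
        qed
        then show False using irr J J_sub unfolding irreducible_coxeter_def by blast
      qed
      then have "\<And>s. s \<in> S \<Longrightarrow> 0 < y s" using yz by (force simp: J_def less_le)
      moreover have "0 \<le> (\<Sum>s\<in>S. y s * std_entry (m t s))" if t: "t \<in> S" for t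
      proof -
        have "0 \<le> (\<Sum>s\<in>S. y s * B (\<alpha> s) (\<alpha> t))" using z yz t by metis
        also have "\<dots> \<le> (\<Sum>s\<in>S. y s * std_entry (m t s))"
          using B_le_std t yz m_sym by (intro sum_mono mult_left_mono) metis+
        finally show ?thesis .
      qed
      ultimately have "std_pos_semidef S m" by (rule psd_of_subharmonic)
      then show False using nonpsd by blast
    qed
    then show "\<forall>i\<in>S <+> S. k i = 0" using z by (auto simp: y_def z_def)
  qed (use finS in auto)
  then obtain x where x: "\<And>i. i \<in> S <+> S \<Longrightarrow> 0 < (\<Sum>t\<in>S. x t * M i t)" by blast
  have "0 < x s" if "s \<in> S" for s
    using x[of "Inr s"] that finS by (auto simp: M_def if_distrib cong: if_cong)
  moreover have "B (\<Sum>t\<in>S. x t *\<^sub>R \<alpha> t) (\<alpha> s) < 0" if "s \<in> S" for s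
    using x[of "Inl s"] that by (subst sym) (auto simp: M_def B_combination sum_negf)
  ultimately show ?thesis by blast
qed

text \<open>
  Let \<open>f = - B v\<close> with \<open>v = \<Sum> x\<^sub>s \<alpha>\<^sub>s\<close>. If \<open>B \<ge> -1\<close> on all pairs of roots, then f is bounded above on the roots. A
  root \<open>\<beta>\<close> whose value under f is almost maximal satisfies \<open>B \<beta> \<alpha>\<^sub>s \<ge> - d'\<close> for all s with d' small, as
  otherwise \<open>s \<beta>\<close> would exceed the supremum. Summing with the weights \<open>x\<^sub>s\<close> shows that \<open>f \<beta>\<close> is almost
  nonpositive, although the supremum is at least the smallest value of f on the simple roots.
\<close>

lemma ex_hyperbolic_pair:
  assumes ne: "S \<noteq> {}"
    and x: "\<And>s. s \<in> S \<Longrightarrow> 0 < x s" and neg: "\<And>s. s \<in> S \<Longrightarrow> B (\<Sum>t\<in>S. x t *\<^sub>R \<alpha> t) (\<alpha> s) < 0"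
  shows "\<exists>\<beta>\<in>\<Phi>. \<exists>\<gamma>\<in>\<Phi>. B \<beta> \<gamma> < - 1"
proof (rule ccontr)
  assume "\<not> ?thesis"
  then have ge: "- 1 \<le> B \<beta> \<gamma>" if "\<beta> \<in> \<Phi>" "\<gamma> \<in> \<Phi>" for \<beta> \<gamma> using that by force
  define v where "v = (\<Sum>t\<in>S. x t *\<^sub>R \<alpha> t)"
  define f where "f u = - B v u" for u
  define X where "X = (\<Sum>s\<in>S. x s)"
  have X: "0 \<le> X" unfolding X_def using x by (intro sum_nonneg) (auto simp: less_imp_le)
  define e where "e = Min ((\<lambda>s. f (\<alpha> s)) ` S)"
  have e: "0 < e" "\<And>s. s \<in> S \<Longrightarrow> e \<le> f (\<alpha> s)"
    unfolding e_def using finS neg ne by (auto simp: f_def v_def)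
  have bdd: "f \<beta> \<le> X" if "\<beta> \<in> \<Phi>" for \<beta>
    unfolding f_def v_def B_combination X_def sum_negf[symmetric]
  proof (rule sum_mono)
    fix s assume s: "s \<in> S"
    have "x s * - 1 \<le> x s * B (\<alpha> s) \<beta>" using x[OF s] ge[OF simple_root[OF s] that] by (intro mult_left_mono) auto
    then show "- (x s * B (\<alpha> s) \<beta>) \<le> x s" by simp
  qed
  define M where "M = Sup (f ` \<Phi>)"
  have bdd': "bdd_above (f ` \<Phi>)" using bdd by (auto intro!: bdd_aboveI[of _ X])
  have M: "f \<beta> \<le> M" if "\<beta> \<in> \<Phi>" for \<beta> unfolding M_def using that bdd' by (intro cSup_upper) auto
  obtain s0 where s0: "s0 \<in> S" using ne by blast
  have "e \<le> M" using e(2)[OF s0] M[OF simple_root[OF s0]] by simp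
  \<comment> \<open>the value at which the two estimates for \<open>f \<beta>\<close> below contradict each other\<close>
  define d where "d = e / (1 + X / (2 * e))"
  have den: "0 < 1 + X / (2 * e)" using X e by (intro add_pos_nonneg) auto
  have d: "0 < d" using e den by (simp add: d_def)
  have "\<exists>y\<in>f ` \<Phi>. M - d < y"
    using less_cSup_iff[of "f ` \<Phi>" "M - d"] bdd' simple_root[OF s0] d unfolding M_def by auto
  then obtain \<beta> where \<beta>: "\<beta> \<in> \<Phi>" "M - d < f \<beta>" by blast
  have low: "- (d / (2 * e)) \<le> B (\<alpha> s) \<beta>" if s: "s \<in> S" for s
  proof (rule ccontr)
    assume "\<not> ?thesis"
    then have lt: "d / (2 * e) < - B (\<alpha> s) \<beta>" by simp
    have "\<rho> s \<beta> \<in> \<Phi>" using root_act s gen_in \<beta> by blast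
    then have "f (\<rho> s \<beta>) \<le> M" by (rule M)
    moreover have "f (\<rho> s \<beta>) = f \<beta> + 2 * (- B (\<alpha> s) \<beta>) * f (\<alpha> s)"
      using s by (simp add: f_def act_gen B_simps sym[of \<beta>])
    ultimately have "2 * (- B (\<alpha> s) \<beta>) * f (\<alpha> s) < d" using \<beta> by simp
    moreover have "0 < d / (2 * e)" using d e by simp
    then have "2 * (d / (2 * e)) * e \<le> 2 * (- B (\<alpha> s) \<beta>) * f (\<alpha> s)"
      using lt e(2)[OF s] e(1) d by (intro mult_mono) linarith+
    ultimately show False using e by simp
  qed
  have "- (X * (d / (2 * e))) = (\<Sum>s\<in>S. x s * - (d / (2 * e)))"
    by (simp only: X_def sum_distrib_right mult_minus_right sum_negf)
  also have "\<dots> \<le> (\<Sum>s\<in>S. x s * B (\<alpha> s) \<beta>)"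
    using low x by (intro sum_mono mult_left_mono) (auto simp: less_imp_le)
  also have "\<dots> = - f \<beta>" by (simp add: f_def v_def B_combination)
  finally have "f \<beta> \<le> d * (X / (2 * e))" by (simp add: field_simps)
  then have "e < d * (1 + X / (2 * e))" using \<beta>(2) \<open>e \<le> M\<close> by (simp add: algebra_simps)
  also have "\<dots> = e" using den by (simp add: d_def)
  finally show False by simp
qed

end

section \<open>A pair of roots with hyperbolic product\<close>

text \<open>
  The parameter \<open>\<mu>\<close> is the solution greater than 1 of \<open>\<mu> + 1 / \<mu> = - 2 B \<beta> \<gamma>\<close>. In these terms the isotropic
  vectors of the plane of \<open>\<beta>\<close> and \<open>\<gamma>\<close> and the eigenvalues of h are rational expressions.
\<close>

locale hyperbolic_pair = coxeter_rep W S m B \<alpha> \<rho>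
  for W :: "('w, 'x) monoid_scheme" (structure)
    and S :: "'w set"
    and m :: "'w \<Rightarrow> 'w \<Rightarrow> enat"
    and B :: "'v::real_vector \<Rightarrow> 'v \<Rightarrow> real"
    and \<alpha> :: "'w \<Rightarrow> 'v"
    and \<rho> :: "'w \<Rightarrow> 'v \<Rightarrow> 'v" +
  fixes \<beta> \<gamma> :: 'v and \<mu> :: real
  assumes \<beta>: "\<beta> \<in> roots W S \<alpha> \<rho>" and \<gamma>: "\<gamma> \<in> roots W S \<alpha> \<rho>"
    and \<mu>: "1 < \<mu>" and B_\<beta>\<gamma>: "B \<beta> \<gamma> = - (\<mu> + 1 / \<mu>) / 2"
begin

definition p where "p = \<mu> *\<^sub>R \<beta> + \<gamma>"
definition q where "q = \<beta> + \<mu> *\<^sub>R \<gamma>"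
abbreviation "rb \<equiv> root_refl \<beta>"
abbreviation "rc \<equiv> root_refl \<gamma>"
definition h where "h = rb \<otimes> rc"

lemmas rb = root_refl[OF \<beta>] and rc = root_refl[OF \<gamma>]

lemma h: "h \<in> carrier W" using rb rc by (simp add: h_def)

lemma B_pairs: "B \<beta> \<beta> = 1" "B \<gamma> \<gamma> = 1" "B \<gamma> \<beta> = - (\<mu> + 1 / \<mu>) / 2"
  using root_self \<beta> \<gamma> B_\<beta>\<gamma> sym[of \<gamma> \<beta>] by auto

lemma B_pp: "B p p = 0"
  using \<mu> by (simp add: p_def B_simps B_pairs B_\<beta>\<gamma> field_simps)

lemma B_qq: "B q q = 0"
  using \<mu> by (simp add: q_def B_simps B_pairs B_\<beta>\<gamma> field_simps)

lemma B_pq: "B p q < 0"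
proof -
  have "B p q = - ((\<mu>\<^sup>2 - 1)\<^sup>2 / (2 * \<mu>))"
    using \<mu> by (simp add: p_def q_def B_simps B_pairs B_\<beta>\<gamma> field_simps power2_eq_square)
  moreover have "\<mu>\<^sup>2 - 1 \<noteq> 0" using \<mu> by (simp add: power2_eq_1_iff)
  ultimately show ?thesis using \<mu> by simp
qed

lemma \<mu>2: "1 < \<mu>\<^sup>2" using \<mu> by (simp add: one_less_power)

lemma \<beta>_eq: "(\<mu>\<^sup>2 - 1) *\<^sub>R \<beta> = \<mu> *\<^sub>R p - q" and \<gamma>_eq: "(\<mu>\<^sup>2 - 1) *\<^sub>R \<gamma> = \<mu> *\<^sub>R q - p"
  by (simp_all add: p_def q_def algebra_simps power2_eq_square)

lemma B_\<beta>q: "B \<beta> q \<noteq> 0"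
proof -
  have "B \<beta> q = (1 - \<mu>\<^sup>2) / 2" using \<mu>
    by (simp add: q_def B_simps B_pairs B_\<beta>\<gamma> field_simps power2_eq_square)
  then show ?thesis using \<mu>2 by simp
qed

lemma rb_p: "\<rho> rb p = (1 / \<mu>) *\<^sub>R q" and rb_q: "\<rho> rb q = \<mu> *\<^sub>R p"
  and rc_p: "\<rho> rc p = \<mu> *\<^sub>R q" and rc_q: "\<rho> rc q = (1 / \<mu>) *\<^sub>R p"
proof -
  have e: "2 * B p \<beta> = \<mu> - 1 / \<mu>" "2 * B p \<gamma> = 1 - \<mu>\<^sup>2" "2 * B q \<beta> = 1 - \<mu>\<^sup>2" "2 * B q \<gamma> = \<mu> - 1 / \<mu>"
    using \<mu> by (simp_all add: p_def q_def B_simps B_pairs B_\<beta>\<gamma> field_simps power2_eq_square)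
  show "\<rho> rb p = (1 / \<mu>) *\<^sub>R q" "\<rho> rb q = \<mu> *\<^sub>R p" "\<rho> rc p = \<mu> *\<^sub>R q" "\<rho> rc q = (1 / \<mu>) *\<^sub>R p"
    unfolding rb(2) rc(2) e using \<mu> by (simp_all add: p_def q_def algebra_simps power2_eq_square)
qed

lemma h_p: "\<rho> h p = \<mu>\<^sup>2 *\<^sub>R p"
  using rb(1) rc(1) by (simp add: h_def act_mult rc_p rb_q act_simps power2_eq_square)

lemma h_q: "\<rho> h q = (1 / \<mu>\<^sup>2) *\<^sub>R q"
  using rb(1) rc(1) by (simp add: h_def act_mult rc_q rb_p act_simps power2_eq_square)

lemma h_fix:
  assumes "B z p = 0" "B z q = 0"
  shows "\<rho> h z = z"
proof -
  have "(\<mu>\<^sup>2 - 1) * B z \<beta> = 0" "(\<mu>\<^sup>2 - 1) * B z \<gamma> = 0"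
    using arg_cong[OF \<beta>_eq, of "B z"] arg_cong[OF \<gamma>_eq, of "B z"] assms by (simp_all add: B_simps)
  then have "B z \<beta> = 0" "B z \<gamma> = 0" using \<mu>2 by auto
  then show ?thesis using rb rc by (simp add: h_def act_mult)
qed

lemma act_pow_Suc: "\<rho> (h [^] n \<otimes> h) x = \<rho> (h [^] n) (\<rho> h x)" for n :: nat
  using h by (simp add: act_mult)

lemma h_pow_p: "\<rho> (h [^] n) p = (\<mu>\<^sup>2) ^ n *\<^sub>R p" for n :: nat
  by (induction n) (use h in \<open>simp_all add: act_pow_Suc h_p act_simps mult.commute\<close>)

lemma h_pow_q: "\<rho> (h [^] n) q = (1 / \<mu>\<^sup>2) ^ n *\<^sub>R q" for n :: nat
  by (induction n) (use h in \<open>simp_all add: act_pow_Suc h_q act_simps mult.commute\<close>)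

lemma h_pow_fix: "B z p = 0 \<Longrightarrow> B z q = 0 \<Longrightarrow> \<rho> (h [^] n) z = z" for n :: nat
  by (induction n) (use h in \<open>simp_all add: act_pow_Suc h_fix\<close>)

text \<open>
  In the decomposition of x along p, q and the orthogonal complement of the plane, the three parts
  are multiplied by \<open>\<mu>\<^sup>2\<^sup>n\<close>, \<open>\<mu>\<^sup>-\<^sup>2\<^sup>n\<close> and 1.
\<close>

lemma h_pow_tendsto:
  assumes \<phi>: "linear (\<phi> :: 'v \<Rightarrow> real)"
  shows "(\<lambda>n. \<phi> (\<rho> (h [^] n) x) / (\<mu>\<^sup>2) ^ n) \<longlonglongrightarrow> B x q / B p q * \<phi> p"
proof -
  define a where "a = B x q / B p q"
  define b where "b = B x p / B p q"
  define z where "z = x - a *\<^sub>R p - b *\<^sub>R q"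
  define t where "t = 1 / \<mu>\<^sup>2"
  have z: "B z p = 0" "B z q = 0"
    using B_pq by (simp_all add: z_def B_simps B_pp B_qq a_def b_def sym[of q p])
  have "\<rho> (h [^] n) x = ((\<mu>\<^sup>2) ^ n * a) *\<^sub>R p + (t ^ n * b) *\<^sub>R q + z" for n
  proof -
    have "x = a *\<^sub>R p + b *\<^sub>R q + z" by (simp add: z_def)
    then have "\<rho> (h [^] n) x = \<rho> (h [^] n) (a *\<^sub>R p + b *\<^sub>R q + z)" by simp
    then show ?thesis using h
      by (simp add: act_simps h_pow_p h_pow_q h_pow_fix[OF z] t_def mult.commute)
  qed
  then have "\<phi> (\<rho> (h [^] n) x) / (\<mu>\<^sup>2) ^ n = a * \<phi> p + (t ^ n * t ^ n) * (b * \<phi> q) + t ^ n * \<phi> z" for n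
    using \<mu> \<phi> by (simp add: linear_add linear_scale add_divide_distrib t_def power_one_over)
  moreover have "(\<lambda>n. a * \<phi> p + (t ^ n * t ^ n) * (b * \<phi> q) + t ^ n * \<phi> z) \<longlonglongrightarrow> a * \<phi> p + 0 * 0 * (b * \<phi> q) + 0 * \<phi> z"
    by (intro tendsto_intros LIMSEQ_power_zero) (use \<mu>2 in \<open>simp_all add: t_def divide_less_eq\<close>)
  ultimately show ?thesis by (simp add: a_def)
qed

lemma slope_tendsto:
  assumes f: "linear (f :: 'v \<Rightarrow> real)" and g: "linear (g :: 'v \<Rightarrow> real)"
    and w: "w \<in> carrier W" and x: "B x q \<noteq> 0" and fp: "f (\<rho> w p) \<noteq> 0"
  shows "(\<lambda>n. g (\<rho> w (\<rho> (h [^] n) x)) / f (\<rho> w (\<rho> (h [^] n) x))) \<longlonglongrightarrow> g (\<rho> w p) / f (\<rho> w p)"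
proof -
  let ?a = "B x q / B p q"
  have lin: "linear (\<lambda>v. f (\<rho> w v))" "linear (\<lambda>v. g (\<rho> w v))"
    using linear_compose[OF act_linear[OF w] f] linear_compose[OF act_linear[OF w] g] by (auto simp: o_def)
  have "?a \<noteq> 0" using x B_pq by auto
  have "(\<lambda>n. (g (\<rho> w (\<rho> (h [^] n) x)) / (\<mu>\<^sup>2) ^ n) / (f (\<rho> w (\<rho> (h [^] n) x)) / (\<mu>\<^sup>2) ^ n))
      \<longlonglongrightarrow> (?a * g (\<rho> w p)) / (?a * f (\<rho> w p))"
    by (intro tendsto_divide h_pow_tendsto lin) (use \<open>?a \<noteq> 0\<close> fp in auto)
  then show ?thesis using \<open>?a \<noteq> 0\<close> \<mu> by simp
qed

lemma p_span: "w \<in> carrier W \<Longrightarrow> \<rho> w p \<in> span (\<alpha> ` S)"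
  using root_span root_act \<beta> \<gamma> by (auto simp: p_def act_simps intro!: span_add span_scale)

lemma act_p_nonzero: "w \<in> carrier W \<Longrightarrow> \<rho> w p \<noteq> 0"
  using B_pq act_isometry[of w p q] by (auto simp: B_simps)

text \<open>
  On nonnegative combinations of simple roots, and hence on all roots, each linear functional g
  is bounded by a multiple of f in absolute value. This bound passes to the limit direction
  \<open>w p\<close>, and some functional g does not vanish there.
\<close>

lemma slope_denominator_nonzero:
  assumes f: "linear (f :: 'v \<Rightarrow> real)" and pos: "\<And>s. s \<in> S \<Longrightarrow> 0 < f (\<alpha> s)"
    and w: "w \<in> carrier W"
  shows "f (\<rho> w p) \<noteq> 0"
proof -
  obtain g :: "'v \<Rightarrow> real" where g: "linear g" "g (\<rho> w p) \<noteq> 0"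
    using generic_functional[of "\<alpha> ` S" "{\<rho> w p}"] finS p_span[OF w] act_p_nonzero[OF w] by auto
  define C where "C = (\<Sum>s\<in>S. \<bar>g (\<alpha> s)\<bar> / f (\<alpha> s))"
  have C_nonneg: "0 \<le> C"
    unfolding C_def using pos by (intro sum_nonneg divide_nonneg_pos) auto
  have simple: "\<bar>g (\<alpha> s)\<bar> \<le> C * f (\<alpha> s)" if "s \<in> S" for s
  proof -
    have "\<bar>g (\<alpha> s)\<bar> / f (\<alpha> s) \<le> C"
      unfolding C_def using that finS pos by (intro member_le_sum) (auto simp: less_imp_le)
    then show ?thesis using pos[OF that] by (simp add: field_simps)
  qed
  have cone: "\<bar>g v\<bar> \<le> C * \<bar>f v\<bar>" if nn: "nneg v" for v
  proof -
    obtain k where k: "\<forall>s\<in>S. 0 \<le> k s" "v = (\<Sum>s\<in>S. k s *\<^sub>R \<alpha> s)" using nn unfolding nneg_def by blast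
    have "\<bar>g v\<bar> \<le> (\<Sum>s\<in>S. \<bar>k s * g (\<alpha> s)\<bar>)"
      unfolding k(2) using g by (simp add: linear_sum linear_scale)
    also have "\<dots> \<le> (\<Sum>s\<in>S. k s * (C * f (\<alpha> s)))"
      using simple k by (intro sum_mono) (simp add: abs_mult mult_left_mono)
    also have "\<dots> = C * f v"
      unfolding k(2) using f by (simp add: linear_sum linear_scale sum_distrib_left mult_ac)
    also have "\<dots> \<le> C * \<bar>f v\<bar>"
      using C_nonneg by (intro mult_left_mono) auto
    finally show ?thesis .
  qed
  have root: "\<bar>g \<delta>\<bar> \<le> C * \<bar>f \<delta>\<bar>" if "\<delta> \<in> \<Phi>" for \<delta>
    using root_sign[OF that] cone[of \<delta>] cone[of "- \<delta>"] f g by (auto simp: linear_neg)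
  have lin: "linear (\<lambda>v. f (\<rho> w v))" "linear (\<lambda>v. g (\<rho> w v))"
    using linear_compose[OF act_linear[OF w] f] linear_compose[OF act_linear[OF w] g(1)] by (auto simp: o_def)
  let ?a = "B \<beta> q / B p q"
  have le: "\<bar>?a * g (\<rho> w p)\<bar> \<le> C * \<bar>?a * f (\<rho> w p)\<bar>"
  proof (rule LIMSEQ_le)
    show "(\<lambda>n. \<bar>g (\<rho> w (\<rho> (h [^] n) \<beta>)) / (\<mu>\<^sup>2) ^ n\<bar>) \<longlonglongrightarrow> \<bar>?a * g (\<rho> w p)\<bar>"
      by (intro tendsto_rabs h_pow_tendsto lin)
    show "(\<lambda>n. C * \<bar>f (\<rho> w (\<rho> (h [^] n) \<beta>)) / (\<mu>\<^sup>2) ^ n\<bar>) \<longlonglongrightarrow> C * \<bar>?a * f (\<rho> w p)\<bar>"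
      by (intro tendsto_rabs tendsto_mult tendsto_const h_pow_tendsto lin)
    show "\<exists>N. \<forall>n\<ge>N. \<bar>g (\<rho> w (\<rho> (h [^] n) \<beta>)) / (\<mu>\<^sup>2) ^ n\<bar> \<le> C * \<bar>f (\<rho> w (\<rho> (h [^] n) \<beta>)) / (\<mu>\<^sup>2) ^ n\<bar>"
    proof (intro exI allI impI)
      fix n :: nat
      have "\<rho> w (\<rho> (h [^] n) \<beta>) \<in> \<Phi>" using \<beta> w h root_act by simp
      from root[OF this] show "\<bar>g (\<rho> w (\<rho> (h [^] n) \<beta>)) / (\<mu>\<^sup>2) ^ n\<bar> \<le> C * \<bar>f (\<rho> w (\<rho> (h [^] n) \<beta>)) / (\<mu>\<^sup>2) ^ n\<bar>"
        by (simp add: abs_divide divide_right_mono)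
    qed
  qed
  have nz: "?a * g (\<rho> w p) \<noteq> 0" using g B_\<beta>q B_pq by auto
  show ?thesis
  proof
    assume "f (\<rho> w p) = 0"
    then have "\<bar>?a * g (\<rho> w p)\<bar> \<le> 0" using le by (simp only: mult_zero_right abs_zero)
    then show False using nz by (simp only: abs_le_zero_iff)
  qed
qed

section \<open>Elements moving the limit direction\<close>

text \<open>
  Suppose that each root lies in the plane or is orthogonal to p. The reflection in \<open>\<beta>\<close> preserves the
  plane and exchanges the lines of p and q, so each root lies in the plane or is orthogonal to
  it. By irreducibility all simple roots lie in the plane. Three unit vectors in a plane of
  signature (1,1) cannot have pairwise nonpositive products: on the hyperbola of unit
  vectors, two points on the same branch have product at least 1.
\<close>

lemma ex_root_off_plane:
  assumes irr: "irreducible_coxeter S m" and card: "3 \<le> card S"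
  shows "\<exists>\<delta>\<in>\<Phi>. B p \<delta> \<noteq> 0 \<and> (\<forall>a b. \<delta> \<noteq> a *\<^sub>R p + b *\<^sub>R q)"
proof (rule ccontr)
  assume neg: "\<not> ?thesis"
  define P where "P = {a *\<^sub>R p + b *\<^sub>R q | a b. True}"
  have dich: "B \<delta> p = 0 \<and> B \<delta> q = 0" if \<delta>: "\<delta> \<in> \<Phi>" "\<delta> \<notin> P" for \<delta>
  proof -
    have off: "B p \<epsilon> = 0" if "\<epsilon> \<in> \<Phi>" "\<epsilon> \<notin> P" for \<epsilon> using neg that by (auto simp: P_def)
    have inv: "\<rho> rb (\<rho> rb \<delta>) = \<delta>"
      by (simp add: rb B_simps B_pairs algebra_simps)
    have "\<rho> rb \<delta> \<notin> P"
    proof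
      assume "\<rho> rb \<delta> \<in> P"
      then obtain a b where "\<rho> rb \<delta> = a *\<^sub>R p + b *\<^sub>R q" by (auto simp: P_def)
      then have "\<delta> = \<rho> rb (a *\<^sub>R p + b *\<^sub>R q)" using inv by simp
      also have "\<dots> = (b * \<mu>) *\<^sub>R p + (a / \<mu>) *\<^sub>R q" using rb(1) by (simp add: act_simps rb_p rb_q)
      finally show False using \<delta> by (auto simp: P_def)
    qed
    then have "B p (\<rho> rb \<delta>) = 0" using off root_act rb \<delta> by blast
    then have "B (\<rho> rb p) \<delta> = 0" using act_isometry[OF rb(1), of p "\<rho> rb \<delta>"] inv by simp
    then show ?thesis using off[OF \<delta>] \<mu> sym[of \<delta>] by (simp add: rb_p B_simps)
  qed
  define J where "J = {s \<in> S. \<alpha> s \<in> P}"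
  have "J \<noteq> {}"
  proof
    assume "J = {}"
    then have z: "B (\<alpha> s) q = 0" if "s \<in> S" for s using dich[OF simple_root[OF that]] that by (auto simp: J_def)
    have "p \<in> span (\<alpha> ` S)" using p_span[of \<one>] by simp
    then have "B p q = 0"
      by (induction rule: span_induct_alt) (auto simp: B_simps z)
    then show False using B_pq by simp
  qed
  moreover have "m s t = 2" if "s \<in> J" "t \<in> S - J" for s t
  proof -
    have st: "s \<in> S" "t \<in> S" "s \<noteq> t" "\<alpha> s \<in> P" "\<alpha> t \<notin> P" using that by (auto simp: J_def)
    then obtain a b where "\<alpha> s = a *\<^sub>R p + b *\<^sub>R q" by (auto simp: P_def)
    then have "B (\<alpha> s) (\<alpha> t) = 0"
      using dich[OF simple_root[OF st(2)] st(5)] by (simp add: B_simps sym[of _ "\<alpha> t"])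
    then show ?thesis using B_zero_imp_commute st by blast
  qed
  moreover have "J \<subseteq> S" by (auto simp: J_def)
  ultimately have "J = S" using irr unfolding irreducible_coxeter_def by blast
  then have "\<forall>s\<in>S. \<exists>a b. \<alpha> s = a *\<^sub>R p + b *\<^sub>R q" by (auto simp: J_def P_def)
  then obtain a b where ab: "\<And>s. s \<in> S \<Longrightarrow> \<alpha> s = a s *\<^sub>R p + b s *\<^sub>R q" by metis
  have one: "2 * a s * b s * B p q = 1" if "s \<in> S" for s
    using B_simple_self[OF that] unfolding ab[OF that]
    by (simp add: B_simps B_pp B_qq sym[of q p] algebra_simps)
  \<comment> \<open>the coordinates along p of two simple roots have opposite signs, which is impossible for three of them\<close>
  have opp: "a s * a t < 0" if st: "s \<in> S" "t \<in> S" "s \<noteq> t" for s t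
  proof -
    have "(a s * b t + a t * b s) * B p q \<le> 0"
      using B_offdiag[OF st] unfolding ab[OF st(1)] ab[OF st(2)]
      by (simp add: B_simps B_pp B_qq sym[of q p] algebra_simps)
    moreover have "2 * ((a s * b t + a t * b s) * B p q) * (a s * a t)
        = (a s)\<^sup>2 * (2 * a t * b t * B p q) + (a t)\<^sup>2 * (2 * a s * b s * B p q)"
      by (simp add: power2_eq_square algebra_simps)
    then have "2 * ((a s * b t + a t * b s) * B p q) * (a s * a t) = (a s)\<^sup>2 + (a t)\<^sup>2"
      by (simp only: one[OF st(1)] one[OF st(2)])
    moreover have "a s \<noteq> 0" using one[OF st(1)] by auto
    then have "0 < (a s)\<^sup>2 + (a t)\<^sup>2" by (simp add: sum_power2_gt_zero_iff)
    ultimately show ?thesis by (smt (verit) mult_nonneg_nonneg mult_nonpos_nonneg)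
  qed
  obtain T where "T \<subseteq> S" "card T = 3" using card by (rule obtain_subset_with_card_n)
  then obtain s t u where "s \<in> S" "t \<in> S" "u \<in> S" "s \<noteq> t" "s \<noteq> u" "t \<noteq> u"
    by (auto simp: card_3_iff)
  then have "a s * a t < 0" "a s * a u < 0" "a t * a u < 0" using opp by auto
  then show False by (auto simp: mult_less_0_iff)
qed

text \<open>
  For \<open>u = r\<^sub>\<beta> r\<^sub>\<delta>\<close> the product of \<open>u p\<close> with q is a multiple of that of \<open>r\<^sub>\<delta> p\<close> with p, which is
  \<open>- 2 (B p \<delta>)\<^sup>2\<close>. If \<open>u p\<close> were a multiple of p, then \<open>r\<^sub>\<delta> p\<close> would be a multiple of q and \<open>\<delta>\<close> would lie in the
  plane.
\<close>

lemma ex_moving_element: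
  assumes "irreducible_coxeter S m" "3 \<le> card S"
  shows "\<exists>u\<in>carrier W. B (\<rho> u p) q \<noteq> 0 \<and> (\<forall>c. \<rho> u p \<noteq> c *\<^sub>R p)"
proof -
  obtain \<delta> where \<delta>: "\<delta> \<in> \<Phi>" "B p \<delta> \<noteq> 0" "\<And>a b. \<delta> \<noteq> a *\<^sub>R p + b *\<^sub>R q"
    using ex_root_off_plane[OF assms] by blast
  let ?r = "root_refl \<delta>"
  note r = root_refl[OF \<delta>(1)]
  have u: "\<rho> (rb \<otimes> ?r) p = \<rho> rb (\<rho> ?r p)" using r rb by (simp add: act_mult)
  have "B (\<rho> rb (\<rho> ?r p)) (\<rho> rb (\<mu> *\<^sub>R p)) = \<mu> * (- 2 * (B p \<delta>)\<^sup>2)"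
    using rb(1) by (simp only: act_isometry) (simp add: r B_simps B_pp sym[of \<delta> p] power2_eq_square)
  moreover have inv: "\<rho> rb (\<mu> *\<^sub>R p) = q" using rb(1) \<mu> by (simp add: act_simps rb_p)
  ultimately have "B (\<rho> (rb \<otimes> ?r) p) q \<noteq> 0" using \<mu> \<delta> u by simp
  moreover have "\<rho> (rb \<otimes> ?r) p \<noteq> c *\<^sub>R p" for c
  proof
    assume "\<rho> (rb \<otimes> ?r) p = c *\<^sub>R p"
    then have "\<rho> rb (\<rho> ?r p) = \<rho> rb ((c / \<mu>) *\<^sub>R q)" using u rb(1) \<mu> by (simp add: act_simps rb_q)
    then have "\<rho> ?r p = (c / \<mu>) *\<^sub>R q" using act_inv(1)[OF rb(1)] by metis
    then have "(2 * B p \<delta>) *\<^sub>R \<delta> = p - (c / \<mu>) *\<^sub>R q" using r(2)[of p] by (simp add: algebra_simps)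
    then have "(1 / (2 * B p \<delta>)) *\<^sub>R (2 * B p \<delta>) *\<^sub>R \<delta> = (1 / (2 * B p \<delta>)) *\<^sub>R (p - (c / \<mu>) *\<^sub>R q)" by simp
    then have "\<delta> = (1 / (2 * B p \<delta>)) *\<^sub>R p + (- (c / \<mu>) / (2 * B p \<delta>)) *\<^sub>R q"
      using \<delta>(2) by (simp add: scaleR_diff_right mult.commute)
    then show False using \<delta>(3) by blast
  qed
  ultimately show ?thesis using r rb by blast
qed

section \<open>The reflection order\<close>

text \<open>
  The functional g is chosen so that two vectors among the roots and the limit directions \<open>w p\<close>
  have equal slopes only if they are proportional. On positive roots proportional means equal, as
  all roots have norm 1.
\<close>

lemma ex_non_scattered_order:
  assumes irr: "irreducible_coxeter S m" and card: "3 \<le> card S"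
    and f: "linear (f :: 'v \<Rightarrow> real)" and pos: "\<And>s. s \<in> S \<Longrightarrow> 0 < f (\<alpha> s)"
  shows "\<exists>r. reflection_order (pos_roots W S \<alpha> \<rho>) r \<and> \<not> scattered (pos_roots W S \<alpha> \<rho>) r"
proof -
  let ?P = "pos_roots W S \<alpha> \<rho>"
  define Z where "Z = \<Phi> \<union> (\<lambda>w. \<rho> w p) ` carrier W"
  \<comment> \<open>the vector that g must not annihilate for the slopes of x and y to differ\<close>
  define N where "N = (\<lambda>(x, y). f y *\<^sub>R x - f x *\<^sub>R y) ` (Z \<times> Z) - {0}"
  have "countable Z" using countable_roots countable_carrier by (simp add: Z_def)
  then have "countable N" by (simp add: N_def)
  have "Z \<subseteq> span (\<alpha> ` S)" using root_span p_span by (auto simp: Z_def)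
  then have "N \<subseteq> span (\<alpha> ` S)" by (auto simp: N_def intro!: span_diff span_scale)
  then obtain g :: "'v \<Rightarrow> real" where g: "linear g" "\<And>v. v \<in> N \<Longrightarrow> g v \<noteq> 0"
    using generic_functional[of "\<alpha> ` S" N] finS \<open>countable N\<close> by (auto simp: N_def)
  define k where "k v = g v / f v" for v
  have k_eq: "f y *\<^sub>R x = f x *\<^sub>R y" if "x \<in> Z" "y \<in> Z" "f x \<noteq> 0" "f y \<noteq> 0" "k x = k y" for x y
  proof (rule ccontr)
    assume "f y *\<^sub>R x \<noteq> f x *\<^sub>R y"
    then have "f y *\<^sub>R x - f x *\<^sub>R y \<in> N" using that by (auto simp: N_def)
    then have "g (f y *\<^sub>R x - f x *\<^sub>R y) \<noteq> 0" by (rule g)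
    then show False using that f g by (simp add: k_def linear_diff linear_scale field_simps)
  qed
  have f_pos: "0 < f x" if "x \<in> ?P" for x
  proof -
    have x: "x \<in> \<Phi>" "nneg x" using that by (auto simp: pos_roots_eq)
    then obtain l where l: "\<forall>s\<in>S. 0 \<le> l s" "x = (\<Sum>s\<in>S. l s *\<^sub>R \<alpha> s)" by (auto simp: nneg_def)
    have "x \<noteq> 0" using root_self[OF x(1)] by (auto simp: B_simps)
    then have "\<exists>s\<in>S. l s \<noteq> 0" unfolding l(2) by (auto intro: ccontr)
    then obtain s where s: "s \<in> S" "l s \<noteq> 0" by blast
    have "0 < (\<Sum>s\<in>S. l s * f (\<alpha> s))"
    proof (rule sum_pos2[OF finS s(1)])
      show "0 < l s * f (\<alpha> s)" using l s pos by (simp add: less_le)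
    qed (use l pos in \<open>auto simp: less_imp_le\<close>)
    then show ?thesis unfolding l(2) using f by (simp add: linear_sum linear_scale)
  qed
  have fp: "f (\<rho> w p) \<noteq> 0" if "w \<in> carrier W" for w
    using slope_denominator_nonzero[OF f pos that] by simp
  have inj: "inj_on k ?P"
  proof (rule inj_onI)
    fix x y assume x: "x \<in> ?P" and y: "y \<in> ?P" and "k x = k y"
    then have e: "f y *\<^sub>R x = f x *\<^sub>R y"
      using k_eq[of x y] f_pos[OF x] f_pos[OF y] by (auto simp: Z_def pos_roots_eq)
    have "B (f y *\<^sub>R x) (f y *\<^sub>R x) = (f y)\<^sup>2" "B (f x *\<^sub>R y) (f x *\<^sub>R y) = (f x)\<^sup>2"
      using x y root_self by (simp_all add: pos_roots_eq B_simps power2_eq_square)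
    then have "f x = f y" using e f_pos[OF x] f_pos[OF y] by (simp add: power2_eq_iff)
    then show "x = y" using e f_pos[OF y] by simp
  qed
  let ?r = "{(x, y) \<in> ?P \<times> ?P. k x < k y}"
  have "reflection_order ?P ?r"
    using reflection_order_of_slope[OF f g(1) f_pos] inj unfolding k_def by blast
  moreover
  define Q where "Q = (\<lambda>w. k (\<rho> w p)) ` carrier W"
  obtain u where u: "u \<in> carrier W" "B (\<rho> u p) q \<noteq> 0" "\<And>c. \<rho> u p \<noteq> c *\<^sub>R p"
    using ex_moving_element[OF irr card] by blast
  have "\<exists>D\<subseteq>k ` ?P. (\<exists>x\<in>D. \<exists>y\<in>D. x \<noteq> y) \<and> (\<forall>a\<in>D. \<forall>b\<in>D. a < b \<longrightarrow> (\<exists>c\<in>D. a < c \<and> c < b))"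
  proof (rule dense_suborder_of_reals)
    show "Q \<noteq> {}" using one_closed by (auto simp: Q_def)
  next
    fix x assume "x \<in> Q"
    then obtain w where w: "w \<in> carrier W" "x = k (\<rho> w p)" by (auto simp: Q_def)
    define X where "X n = k (\<rho> w (\<rho> (h [^] n) (\<rho> u p)))" for n :: nat
    have "X \<longlonglongrightarrow> x"
      unfolding X_def w(2) k_def by (rule slope_tendsto[OF f g(1) w(1) u(2) fp[OF w(1)]])
    moreover have "X n \<in> Q - {x}" for n
    proof -
      have mem: "w \<otimes> (h [^] n \<otimes> u) \<in> carrier W" using w u h by simp
      have eq: "\<rho> w (\<rho> (h [^] n) (\<rho> u p)) = \<rho> (w \<otimes> (h [^] n \<otimes> u)) p"
        using w u h by (simp add: act_mult)
      have "X n \<noteq> x"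
      proof
        assume "X n = x"
        then have "f (\<rho> w p) *\<^sub>R \<rho> w (\<rho> (h [^] n) (\<rho> u p)) = f (\<rho> w (\<rho> (h [^] n) (\<rho> u p))) *\<^sub>R \<rho> w p"
          using fp mem w unfolding X_def w(2) eq by (intro k_eq) (auto simp: Z_def)
        then have "\<rho> w (\<rho> (h [^] n) (\<rho> u p)) = (f (\<rho> w (\<rho> (h [^] n) (\<rho> u p))) / f (\<rho> w p)) *\<^sub>R \<rho> w p"
          using fp[OF w(1)] by (metis (no_types, lifting) divide_inverse_commute scaleR_one scaleR_scaleR left_inverse)
        then obtain c where "\<rho> w (\<rho> (h [^] n) (\<rho> u p)) = c *\<^sub>R \<rho> w p" by blast
        also have "\<dots> = \<rho> w (\<rho> (h [^] n) ((c / (\<mu>\<^sup>2) ^ n) *\<^sub>R p))"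
          using w h \<mu> by (simp add: act_simps h_pow_p)
        finally have "\<rho> u p = (c / (\<mu>\<^sup>2) ^ n) *\<^sub>R p"
          using act_inv(1)[OF w(1)] act_inv(1)[of "h [^] n"] h by (metis nat_pow_closed)
        then show False using u(3) by blast
      qed
      then show ?thesis using mem unfolding X_def eq by (auto simp: Q_def)
    qed
    ultimately show "x islimpt Q" unfolding islimpt_sequential by blast
  next
    show "Q \<subseteq> closure (k ` ?P)"
    proof
      fix x assume "x \<in> Q"
      then obtain w where w: "w \<in> carrier W" "x = k (\<rho> w p)" by (auto simp: Q_def)
      define X where "X n = k (\<rho> w (\<rho> (h [^] n) \<beta>))" for n :: nat
      have "X \<longlonglongrightarrow> x"
        unfolding X_def w(2) k_def by (rule slope_tendsto[OF f g(1) w(1) B_\<beta>q fp[OF w(1)]])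
      moreover have "X n \<in> k ` ?P" for n
      proof -
        let ?d = "\<rho> w (\<rho> (h [^] n) \<beta>)"
        have "?d \<in> \<Phi>" using \<beta> w h root_act by simp
        then have "?d \<in> ?P \<or> - ?d \<in> ?P" using root_sign root_uminus by (auto simp: pos_roots_eq)
        moreover have "k (- ?d) = k ?d" using f g by (simp add: k_def linear_neg)
        ultimately show ?thesis unfolding X_def by (metis imageI)
      qed
      ultimately show "x \<in> closure (k ` ?P)" unfolding closure_sequential by blast
    qed
  qed
  then obtain D where "D \<subseteq> k ` ?P" "\<exists>x\<in>D. \<exists>y\<in>D. x \<noteq> y"
    "\<forall>a\<in>D. \<forall>b\<in>D. a < b \<longrightarrow> (\<exists>c\<in>D. a < c \<and> c < b)" by blast
  then have "\<not> scattered ?P ?r" by (rule not_scattered_of_slope)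
  ultimately show ?thesis by blast
qed

end

theorem lemma4p1:
  fixes W :: "('w, 'x) monoid_scheme"
    and S :: "'w set"
    and m :: "'w \<Rightarrow> 'w \<Rightarrow> enat"
    and B :: "'v::real_vector \<Rightarrow> 'v \<Rightarrow> real"
    and \<alpha> :: "'w \<Rightarrow> 'v"
    and \<rho> :: "'w \<Rightarrow> 'v \<Rightarrow> 'v"
  assumes "coxeter_system W S m"
    and "finite S"
    and "3 \<le> card S"
    and "infinite (carrier W)"
    and "irreducible_coxeter S m"
    and "\<not> affine_coxeter S m"
    and "bilinear B"
    and "\<And>u v. B u v = B v u"
    and "root_basis S m B \<alpha>"
    and "reflection_action W S B \<alpha> \<rho>"
  shows "\<exists>r. reflection_order (pos_roots W S \<alpha> \<rho>) r \<and> \<not> scattered (pos_roots W S \<alpha> \<rho>) r"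
proof -
  interpret coxeter_rep W S m B \<alpha> \<rho> by (intro coxeter_rep.intro assms)
  have "\<not> std_pos_def S m" using finite_of_pos_def assms(4) by blast
  then have "\<not> std_pos_semidef S m" using assms(6) by (simp add: affine_coxeter_def)
  then obtain x where x: "\<And>s. s \<in> S \<Longrightarrow> 0 < x s" "\<And>s. s \<in> S \<Longrightarrow> B (\<Sum>t\<in>S. x t *\<^sub>R \<alpha> t) (\<alpha> s) < 0"
    using ex_negative_vector[OF assms(5)] by blast
  have "S \<noteq> {}" using assms(5) by (simp add: irreducible_coxeter_def)
  from ex_hyperbolic_pair[OF this x] obtain \<beta> \<gamma> where \<beta>\<gamma>: "\<beta> \<in> \<Phi>" "\<gamma> \<in> \<Phi>" "B \<beta> \<gamma> < - 1" by blast
  define c where "c = - B \<beta> \<gamma>"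
  define \<mu> where "\<mu> = c + sqrt (c\<^sup>2 - 1)"
  have c: "1 < c" using \<beta>\<gamma> by (simp add: c_def)
  then have "0 < c\<^sup>2 - 1" by (simp add: one_less_power)
  then have sq: "0 < sqrt (c\<^sup>2 - 1)" "(sqrt (c\<^sup>2 - 1))\<^sup>2 = c\<^sup>2 - 1" by auto
  have \<mu>: "1 < \<mu>" using c sq(1) unfolding \<mu>_def by linarith
  have "\<mu>\<^sup>2 + 1 = 2 * c * \<mu>" using sq(2) unfolding \<mu>_def by (simp add: power2_eq_square algebra_simps)
  then have eq: "B \<beta> \<gamma> = - (\<mu> + 1 / \<mu>) / 2" using \<mu> by (simp add: c_def field_simps power2_eq_square)
  interpret hyperbolic_pair W S m B \<alpha> \<rho> \<beta> \<gamma> \<mu>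
    by unfold_locales (fact \<beta>\<gamma>(1) \<beta>\<gamma>(2) \<mu> eq)+
  show ?thesis
  proof (rule ex_non_scattered_order[OF assms(5,3)])
    show "linear (\<lambda>v. - B (\<Sum>t\<in>S. x t *\<^sub>R \<alpha> t) v)"
      by (rule linearI) (simp_all add: B_simps)
    show "0 < - B (\<Sum>t\<in>S. x t *\<^sub>R \<alpha> t) (\<alpha> s)" if "s \<in> S" for s using x(2)[OF that] by simp
  qed
qed

end
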